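(* Let $\tau$ be an infinite cardinal. Let $X$ be a locally compact space which can be covered by at most $\tau$ compact subsets and each regular closed subset of which is $C^{\ast}$-embedded in $X$. Let $L$ be a compact $\operatorname{ANR}$-space embedded into the Tychonov cube $I^{\tau}$ as a $Z_{\tau}$-set. Then the following conditions are equivalent: (a) $L \in \operatorname{AE}(\beta X \setminus X)$; (b) $I^{\tau} \setminus L \in \operatorname{AE}_{p}(X)$.
   Context: All spaces are Tychonov and all maps are continuous; $I=[0,1]$ and $\beta X$ is the Stone-Čech compactification of $X$. A map $f\colon X\to Y$ is proper if $f^{-1}(C)$ is compact for every compact $C\subset Y$. A regular closed subset is the closure of an open subset. A subset $F\subset X$ is $C^{\ast}$-embedded in $X$ if every bounded continuous real-valued function on $F$ extends to a bounded continuous real-valued function on $X$. $Y\in\operatorname{AE}(X)$ means that every map $f\colon A\to Y$ defined on a closed subset $A\subset X$ extends to a map $X\to Y$. For locally compact $X$ and $Y$, $Y\in\operatorname{AE}_p(X)$ means that every proper map $f\colon A\to Y$ defined on a closed $C^{\ast}$-embedded subset $A$ of $X$ extends to a proper map $X\to Y$. $Z_\tau$-sets: for a Tychonov space $Y$ let $\operatorname{cov}(Y)$ be the collection of all countable covers of $Y$ by functionally open (cozero) sets. Maps $f,g\colon X\to Y$ are ${\mathcal U}$-close (for a cover ${\mathcal U}$ of $Y$) if for each $x\in X$ some $U\in{\mathcal U}$ contains both $f(x)$ and $g(x)$. For an infinite cardinal $\tau$, $C_\tau(X,Y)$ is the set of continuous maps $X\to Y$ with the topology in which $G$ is open iff for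 each $h\in G$ there is a family $\{{\mathcal U}_t\colon t\in T\}\subseteq\operatorname{cov}(Y)$ with $|T|<\tau$ such that every $g$ that is ${\mathcal U}_t$-close to $h$ for all $t\in T$ belongs to $G$. A closed subset $A\subset X$ is a $Z_\tau$-set in $X$ if $\{f\in C_\tau(X,X)\colon f(X)\cap A=\emptyset\}$ is dense in $C_\tau(X,X)$. *)

theory Defs
  imports "HOL-Analysis.Analysis"
begin

unbundle cardinal_syntax

definition Tychonov_space :: "'a topology \<Rightarrow> bool" where
  "Tychonov_space X \<longleftrightarrow> completely_regular_space X \<and> Hausdorff_space X"

definition regular_closedin :: "'a topology \<Rightarrow> 'a set \<Rightarrow> bool" where
  "regular_closedin X F \<longleftrightarrow> (\<exists>U. openin X U \<and> F = X closure_of U)"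

definition C_star_embedded :: "'a topology \<Rightarrow> 'a set \<Rightarrow> bool" where
  "C_star_embedded X F \<longleftrightarrow> F \<subseteq> topspace X \<and>
     (\<forall>f. continuous_map (subtopology X F) euclideanreal f \<and> bounded (f ` F) \<longrightarrow>
        (\<exists>g. continuous_map X euclideanreal g \<and> bounded (g ` topspace X) \<and> (\<forall>x\<in>F. g x = f x)))"


subsection \<open>Absolute extensors\<close>

text \<open>The range comes first: \<open>abs_extensor Y X\<close> is $Y \in \mathrm{AE}(X)$ and
  \<open>abs_extensor_proper Y X\<close> is $Y \in \mathrm{AE}_p(X)$.\<close>

definition abs_extensor :: "'b topology \<Rightarrow> 'a topology \<Rightarrow> bool" where
  "abs_extensor Y X \<longleftrightarrow>
     (\<forall>A f. closedin X A \<and> continuous_map (subtopology X A) Y f \<longrightarrow>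
        (\<exists>g. continuous_map X Y g \<and> (\<forall>x\<in>A. g x = f x)))"

text \<open>Preimages of compact sets are compact; the library's \<^const>\<open>proper_map\<close> (closed, with compact
  fibres) is a different condition for general spaces.\<close>

definition compact_proper_map :: "'a topology \<Rightarrow> 'b topology \<Rightarrow> ('a \<Rightarrow> 'b) \<Rightarrow> bool" where
  "compact_proper_map X Y f \<longleftrightarrow> continuous_map X Y f \<and>
     (\<forall>C. compactin Y C \<longrightarrow> compactin X {x \<in> topspace X. f x \<in> C})"

definition abs_extensor_proper :: "'b topology \<Rightarrow> 'a topology \<Rightarrow> bool" where
  "abs_extensor_proper Y X \<longleftrightarrow>
     (\<forall>A f. closedin X A \<and> C_star_embedded X A \<and> compact_proper_map (subtopology X A) Y f \<longrightarrow>
        (\<exists>g. compact_proper_map X Y g \<and> (\<forall>x\<in>A. g x = f x)))"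


subsection \<open>The Stone-Cech compactification\<close>

text \<open>The closure of the canonical image of \<open>X\<close> in the cube indexed by all maps from \<open>X\<close> to
  \<open>[0,1]\<close>.\<close>

definition unit_maps :: "'a topology \<Rightarrow> ('a \<Rightarrow> real) set" where
  "unit_maps X = {f \<in> extensional (topspace X). continuous_map X (top_of_set {0..1}) f}"

definition beta_emb :: "'a topology \<Rightarrow> 'a \<Rightarrow> ('a \<Rightarrow> real) \<Rightarrow> real" where
  "beta_emb X x = (\<lambda>f \<in> unit_maps X. f x)"

definition beta :: "'a topology \<Rightarrow> (('a \<Rightarrow> real) \<Rightarrow> real) topology" where
  "beta X =
     (let P = product_topology (\<lambda>_. top_of_set {0..1}) (unit_maps X)
      in subtopology P (P closure_of (beta_emb X ` topspace X)))"

definition beta_remainder :: "'a topology \<Rightarrow> (('a \<Rightarrow> real) \<Rightarrow> real) topology" where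
  "beta_remainder X = subtopology (beta X) (topspace (beta X) - beta_emb X ` topspace X)"

lemma compact_Hausdorff_unit_cube:
  "compact_space (product_topology (\<lambda>_. top_of_set {0..1::real}) I)"
  "Hausdorff_space (product_topology (\<lambda>_. top_of_set {0..1::real}) I)"
  using compact_space_product_topology compact_space_subtopology compactin_euclidean_iff
  by (blast, simp add: Hausdorff_space_product_topology Hausdorff_space_subtopology)

lemma beta_emb_in_cube:
  assumes "x \<in> topspace X"
  shows "beta_emb X x \<in> topspace (product_topology (\<lambda>_. top_of_set {0..1}) (unit_maps X))"
  using assms by (auto simp: beta_emb_def unit_maps_def continuous_map_in_subtopology)

lemma compact_space_beta: "compact_space (beta X)"
  by (simp add: beta_def Let_def closedin_compact_space compact_Hausdorff_unit_cube
      compact_space_subtopology)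

lemma Hausdorff_space_beta: "Hausdorff_space (beta X)"
  by (simp add: beta_def Let_def Hausdorff_space_subtopology compact_Hausdorff_unit_cube)

lemma topspace_beta:
  "topspace (beta X) =
     product_topology (\<lambda>_. top_of_set {0..1}) (unit_maps X) closure_of (beta_emb X ` topspace X)"
  unfolding beta_def Let_def
  using closure_of_subset_topspace by (metis topspace_subtopology_subset)

lemma dense_beta_emb: "beta X closure_of (beta_emb X ` topspace X) = topspace (beta X)"
proof -
  let ?P = "product_topology (\<lambda>_. top_of_set {0..1::real}) (unit_maps X)"
  have "beta_emb X ` topspace X \<subseteq> topspace ?P"
    by (intro image_subsetI beta_emb_in_cube)
  then have "beta_emb X ` topspace X \<subseteq> ?P closure_of (beta_emb X ` topspace X)"
    by (rule closure_of_subset)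
  then have "beta X closure_of (beta_emb X ` topspace X) = ?P closure_of (beta_emb X ` topspace X)"
    by (simp add: closure_of_subtopology beta_def Let_def inf.absorb2)
  then show ?thesis by (simp only: topspace_beta)
qed

lemma embedding_map_beta_emb:
  assumes "Tychonov_space X"
  shows "embedding_map X (beta X) (beta_emb X)"
proof -
  let ?P = "product_topology (\<lambda>_. top_of_set {0..1::real}) (unit_maps X)"
  have "mspace (submetric (cfunspace X euclidean_metric) {f. f \<in> topspace X \<rightarrow> {0..1}}) = unit_maps X"
    (is "?L = ?R")
  proof (intro set_eqI iffI)
    show "f \<in> ?R" if "f \<in> ?L" for f
      using that by (auto simp: unit_maps_def continuous_map_in_subtopology)
    show "f \<in> ?L" if "f \<in> ?R" for f
    proof -
      have "bounded (f ` topspace X)"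
        using that bounded_subset[OF bounded_closed_interval[of 0 1], of "f ` topspace X"]
        by (auto simp: unit_maps_def continuous_map_in_subtopology)
      with that show ?thesis
        by (auto simp: unit_maps_def continuous_map_in_subtopology)
    qed
  qed
  then have "embedding_map X ?P (beta_emb X)"
    using completely_regular_space_cube_embedding_explicit[of X] assms
    by (simp add: Tychonov_space_def beta_emb_def[abs_def])
  moreover have "beta_emb X ` topspace X \<subseteq> ?P closure_of (beta_emb X ` topspace X)"
    by (intro closure_of_subset image_subsetI beta_emb_in_cube)
  ultimately show ?thesis
    unfolding beta_def Let_def embedding_map_in_subtopology by (rule conjI)
qed

lemma beta_extension:
  assumes "continuous_map X (top_of_set {0..1}) f"
  shows "\<exists>g. continuous_map (beta X) (top_of_set {0..1::real}) g \<and>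
             (\<forall>x\<in>topspace X. g (beta_emb X x) = f x)"
proof -
  let ?f = "restrict f (topspace X)"
  have f: "?f \<in> unit_maps X"
    unfolding unit_maps_def using continuous_map_eq[OF assms, of ?f] by simp
  then have "continuous_map (beta X) (top_of_set {0..1}) (\<lambda>p. p ?f)"
    unfolding beta_def Let_def
    by (intro continuous_map_from_subtopology continuous_map_product_projection)
  moreover have "beta_emb X x ?f = f x" if "x \<in> topspace X" for x
    using f that by (simp add: beta_emb_def)
  ultimately show ?thesis by blast
qed


subsection \<open>Tychonov cubes and absolute neighbourhood retracts\<close>

text \<open>A cardinal \<open>\<tau>\<close> is given as a cardinal order in the sense of \<^const>\<open>Card_order\<close>; the coordinates of
  the cube are indexed by its field.\<close>

definition Tychonov_cube :: "'i rel \<Rightarrow> ('i \<Rightarrow> real) topology" where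
  "Tychonov_cube \<tau> = product_topology (\<lambda>_. top_of_set {0..1}) (Field \<tau>)"

text \<open>\<open>L\<close> is a neighbourhood retract of every Tychonov space \<open>Z\<close> that contains a copy of it as a closed
  subset. A definition cannot quantify over all types, so the type carrying \<open>Z\<close> is a parameter;
  by \<open>ANR_space_any_type\<close> below, for compact subspaces of a cube the type of the cube is
  large enough to cover all others.\<close>

definition ANR_space :: "'b itself \<Rightarrow> 'a topology \<Rightarrow> bool" where
  "ANR_space (_ :: 'b itself) L \<longleftrightarrow> Tychonov_space L \<and>
     (\<forall>(Z :: 'b topology) e.
        Tychonov_space Z \<and> embedding_map L Z e \<and> closedin Z (e ` topspace L) \<longrightarrow>
        (\<exists>U. openin Z U \<and> e ` topspace L \<subseteq> U \<and>
             (e ` topspace L) retract_of_space (subtopology Z U)))"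

lemma Tychonov_space_cube: "Tychonov_space (Tychonov_cube \<tau>)"
  unfolding Tychonov_space_def Tychonov_cube_def
  using compact_Hausdorff_unit_cube[of "Field \<tau>"]
  by (simp add: compact_Hausdorff_or_regular_imp_normal_space normal_imp_completely_regular_space)

lemma cube_extension:
  assumes Z: "Tychonov_space Z" and S: "compactin Z S"
    and f: "continuous_map (subtopology Z S) (Tychonov_cube \<tau>) f"
  shows "\<exists>g. continuous_map Z (Tychonov_cube \<tau>) g \<and> (\<forall>x\<in>S. g x = f x)"
proof -
  have sub: "S \<subseteq> topspace Z" using S by (rule compactin_subset_topspace)
  have "\<exists>g. continuous_map Z (top_of_set {0..1}) g \<and> (\<forall>x\<in>S. g x = f x i)" if "i \<in> Field \<tau>" for i
  proof -
    have c: "continuous_map (subtopology Z S) (top_of_set {0..1}) (\<lambda>x. f x i)"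
      using f that by (simp add: Tychonov_cube_def continuous_map_componentwise)
    then have "continuous_map (subtopology Z S) euclideanreal (\<lambda>x. f x i)"
      by (simp add: continuous_map_in_subtopology)
    moreover have "(\<lambda>x. f x i) ` S \<subseteq> {0..1}"
      using continuous_map_image_subset_topspace[OF c] sub by (auto simp: inf.absorb2)
    ultimately obtain g where "continuous_map Z euclideanreal g" "g ` topspace Z \<subseteq> {0..1}"
      "\<And>x. x \<in> S \<Longrightarrow> g x = f x i"
      using Tietze_extension_completely_regular[of Z S "{0..1}" "\<lambda>x. f x i"] Z S
      by (auto simp: Tychonov_space_def is_interval_cc)
    then show ?thesis by (auto simp: continuous_map_in_subtopology)
  qed
  then obtain G where G: "\<And>i. i \<in> Field \<tau> \<Longrightarrow> continuous_map Z (top_of_set {0..1}) (G i)"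
      "\<And>i x. i \<in> Field \<tau> \<Longrightarrow> x \<in> S \<Longrightarrow> G i x = f x i"
    by metis
  have "continuous_map Z (Tychonov_cube \<tau>) (\<lambda>x. \<lambda>i\<in>Field \<tau>. G i x)"
    unfolding Tychonov_cube_def continuous_map_componentwise using G(1) by (auto cong: restrict_cong)
  moreover have "(\<lambda>i\<in>Field \<tau>. G i x) = f x" if "x \<in> S" for x
  proof -
    have "f x \<in> topspace (Tychonov_cube \<tau>)"
      using continuous_map_image_subset_topspace[OF f] that sub by auto
    then have "f x \<in> extensional (Field \<tau>)"
      by (simp add: Tychonov_cube_def PiE_def)
    then show ?thesis
      using G(2) that by (auto simp: extensional_def)
  qed
  ultimately show ?thesis by blast
qed

lemma ANR_space_any_type:
  fixes L :: "('i \<Rightarrow> real) set"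
  assumes L: "compactin (Tychonov_cube \<tau>) L"
    and ANR: "ANR_space TYPE('i \<Rightarrow> real) (subtopology (Tychonov_cube \<tau>) L)"
  shows "ANR_space TYPE('b) (subtopology (Tychonov_cube \<tau>) L)"
  unfolding ANR_space_def
proof (intro conjI allI impI; (elim conjE)?)
  let ?Q = "Tychonov_cube \<tau>"
  let ?L = "subtopology ?Q L"
  show "Tychonov_space ?L" using ANR by (simp add: ANR_space_def)
  have LQ: "L \<subseteq> topspace ?Q" using L by (rule compactin_subset_topspace)
  then have tL: "topspace ?L = L" by auto
  have "closedin ?Q L"
    using L Tychonov_space_cube by (auto simp: Tychonov_space_def intro: compactin_imp_closedin)
  moreover have "embedding_map ?L ?Q id"
    by (simp add: embedding_map_def tL del: topspace_subtopology)
  ultimately have "Tychonov_space ?Q \<and> embedding_map ?L ?Q id \<and> closedin ?Q (id ` L)"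
    by (simp add: Tychonov_space_cube)
  then have "\<exists>V. openin ?Q V \<and> id ` L \<subseteq> V \<and> (id ` L) retract_of_space (subtopology ?Q V)"
    using ANR unfolding ANR_space_def tL by blast
  then obtain V where V: "openin ?Q V" "L \<subseteq> V" "L retract_of_space (subtopology ?Q V)"
    by auto
  then obtain r where r: "continuous_map (subtopology ?Q V) ?L r" "\<And>x. x \<in> L \<Longrightarrow> r x = x"
    by (auto simp: retract_of_space_def subtopology_subtopology inf.absorb2)
  fix Z :: "'b topology" and e
  assume Z: "Tychonov_space Z" and e: "embedding_map ?L Z e" and "closedin Z (e ` topspace ?L)"
  let ?S = "e ` L"
  obtain e' where e': "homeomorphic_maps ?L (subtopology Z ?S) e e'"
    using e unfolding embedding_map_def homeomorphic_map_maps tL by blast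
  then have ce: "continuous_map ?L (subtopology Z ?S) e"
    and ce': "continuous_map (subtopology Z ?S) ?L e'" and e'e: "\<And>x. x \<in> L \<Longrightarrow> e' (e x) = x"
    unfolding homeomorphic_maps_def tL by blast+
  have SZ: "compactin Z ?S"
  proof (rule image_compactin)
    show "compactin ?L L" using L by (simp add: compactin_subtopology)
    show "continuous_map ?L Z e" using ce by (rule continuous_map_into_fulltopology)
  qed
  have "continuous_map (subtopology Z ?S) ?Q e'"
    using ce' by (rule continuous_map_into_fulltopology)
  from cube_extension[OF Z SZ this]
  obtain g where g: "continuous_map Z ?Q g" "\<And>y. y \<in> ?S \<Longrightarrow> g y = e' y"
    by (elim exE conjE) (erule that, erule bspec)
  define U where "U = {z \<in> topspace Z. g z \<in> V}"
  have U: "openin Z U" unfolding U_def using g(1) V(1) by (rule openin_continuous_map_preimage)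
  have SU: "?S \<subseteq> U"
    using compactin_subset_topspace[OF SZ] g(2) e'e V(2) by (auto simp: U_def)
  have "continuous_map (subtopology Z U) (subtopology ?Q V) g"
    by (rule continuous_map_into_subtopology[OF continuous_map_from_subtopology[OF g(1)]])
      (auto simp: U_def)
  then have "continuous_map (subtopology Z U) (subtopology Z ?S) (e \<circ> (r \<circ> g))"
    by (intro continuous_map_compose[OF _ ce] continuous_map_compose[OF _ r(1)])
  moreover have "\<forall>y\<in>?S. (e \<circ> (r \<circ> g)) y = y"
    using g(2) e'e r(2) by auto
  ultimately have "?S retract_of_space (subtopology Z U)"
    using SU compactin_subset_topspace[OF SZ]
    by (auto simp: retract_of_space_def subtopology_subtopology inf.absorb2)
  then show "\<exists>U. openin Z U \<and> e ` topspace ?L \<subseteq> U \<and>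
               (e ` topspace ?L) retract_of_space (subtopology Z U)"
    unfolding tL using U SU by (intro exI[of _ U] conjI)
qed


subsection \<open>Function spaces and $Z_\tau$-sets\<close>

definition functionally_open_in :: "'a topology \<Rightarrow> 'a set \<Rightarrow> bool" where
  "functionally_open_in Y U \<longleftrightarrow>
     (\<exists>f. continuous_map Y euclideanreal f \<and> U = {y \<in> topspace Y. f y \<noteq> 0})"

definition cov :: "'a topology \<Rightarrow> 'a set set set" where
  "cov Y = {\<U>. countable \<U> \<and> (\<forall>U\<in>\<U>. functionally_open_in Y U) \<and> \<Union>\<U> = topspace Y}"

definition close_maps :: "'a topology \<Rightarrow> 'b set set \<Rightarrow> ('a \<Rightarrow> 'b) \<Rightarrow> ('a \<Rightarrow> 'b) \<Rightarrow> bool" where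
  "close_maps X \<U> f g \<longleftrightarrow> (\<forall>x\<in>topspace X. \<exists>U\<in>\<U>. f x \<in> U \<and> g x \<in> U)"

definition cmaps :: "'a topology \<Rightarrow> 'b topology \<Rightarrow> ('a \<Rightarrow> 'b) set" where
  "cmaps X Y = {f \<in> extensional (topspace X). continuous_map X Y f}"

definition C_tau_open :: "'i rel \<Rightarrow> 'a topology \<Rightarrow> 'b topology \<Rightarrow> ('a \<Rightarrow> 'b) set \<Rightarrow> bool" where
  "C_tau_open \<tau> X Y G \<longleftrightarrow> G \<subseteq> cmaps X Y \<and>
     (\<forall>h\<in>G. \<exists>\<V>\<subseteq>cov Y. |\<V>| <o \<tau> \<and>
        (\<forall>g\<in>cmaps X Y. (\<forall>\<U>\<in>\<V>. close_maps X \<U> g h) \<longrightarrow> g \<in> G))"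

definition C_tau :: "'i rel \<Rightarrow> 'a topology \<Rightarrow> 'b topology \<Rightarrow> ('a \<Rightarrow> 'b) topology" where
  "C_tau \<tau> X Y = topology (C_tau_open \<tau> X Y)"

lemma openin_C_tau:
  assumes \<tau>: "Cinfinite \<tau>"
  shows "openin (C_tau \<tau> X Y) G \<longleftrightarrow> C_tau_open \<tau> X Y G"
proof -
  have ex: "\<exists>\<V>\<subseteq>cov Y. |\<V>| <o \<tau> \<and>
      (\<forall>g\<in>cmaps X Y. (\<forall>\<U>\<in>\<V>. close_maps X \<U> g h) \<longrightarrow> g \<in> G)"
    if "C_tau_open \<tau> X Y G" "h \<in> G" for G h
    using that by (simp add: C_tau_open_def)
  have "C_tau_open \<tau> X Y (S \<inter> T)" if S: "C_tau_open \<tau> X Y S" and T: "C_tau_open \<tau> X Y T" for S T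
    unfolding C_tau_open_def
  proof (intro conjI ballI)
    show "S \<inter> T \<subseteq> cmaps X Y" using S by (auto simp: C_tau_open_def)
    fix h assume "h \<in> S \<inter> T"
    then have hS: "h \<in> S" and hT: "h \<in> T" by auto
    from ex[OF S hS] obtain \<V> where V: "\<V> \<subseteq> cov Y" "|\<V>| <o \<tau>"
      "\<forall>g\<in>cmaps X Y. (\<forall>\<U>\<in>\<V>. close_maps X \<U> g h) \<longrightarrow> g \<in> S" by (elim exE conjE) (rule that)
    from ex[OF T hT] obtain \<W> where W: "\<W> \<subseteq> cov Y" "|\<W>| <o \<tau>"
      "\<forall>g\<in>cmaps X Y. (\<forall>\<U>\<in>\<W>. close_maps X \<U> g h) \<longrightarrow> g \<in> T" by (elim exE conjE) (rule that)
    have "|\<V> \<union> \<W>| <o \<tau>"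
      using V(2) W(2) \<tau> by (rule Un_Cinfinite_bound_strict)
    with V W show "\<exists>\<V>\<subseteq>cov Y. |\<V>| <o \<tau> \<and>
        (\<forall>g\<in>cmaps X Y. (\<forall>\<U>\<in>\<V>. close_maps X \<U> g h) \<longrightarrow> g \<in> S \<inter> T)"
      by (intro exI[of _ "\<V> \<union> \<W>"]) auto
  qed
  moreover have "C_tau_open \<tau> X Y (\<Union>\<K>)" if K: "\<forall>K\<in>\<K>. C_tau_open \<tau> X Y K" for \<K>
    unfolding C_tau_open_def
  proof (intro conjI ballI)
    show "\<Union>\<K> \<subseteq> cmaps X Y" using K by (auto simp: C_tau_open_def)
    fix h assume "h \<in> \<Union>\<K>"
    then obtain K' where K': "K' \<in> \<K>" "h \<in> K'" by blast
    from ex[OF K[rule_format, OF K'(1)] K'(2)]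
    obtain \<V> where V: "\<V> \<subseteq> cov Y" "|\<V>| <o \<tau>"
      "\<forall>g\<in>cmaps X Y. (\<forall>\<U>\<in>\<V>. close_maps X \<U> g h) \<longrightarrow> g \<in> K'" by (elim exE conjE) (rule that)
    show "\<exists>\<V>\<subseteq>cov Y. |\<V>| <o \<tau> \<and>
        (\<forall>g\<in>cmaps X Y. (\<forall>\<U>\<in>\<V>. close_maps X \<U> g h) \<longrightarrow> g \<in> \<Union>\<K>)"
      using V K'(1) by (intro exI[of _ \<V>]) auto
  qed
  ultimately have "istopology (C_tau_open \<tau> X Y)"
    unfolding istopology_def by blast
  then show ?thesis by (simp add: C_tau_def topology_inverse')
qed

lemma topspace_C_tau:
  fixes X :: "'a topology" and Y :: "'b topology"
  assumes \<tau>: "Cinfinite \<tau>"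
  shows "topspace (C_tau \<tau> X Y) = cmaps X Y"
proof -
  have "|{} :: 'b set set set| <o \<tau>"
    using \<tau> by (intro Cfinite_ordLess_Cinfinite) (simp_all add: cfinite_def Field_card_of card_of_card_order_on)
  then have "C_tau_open \<tau> X Y (cmaps X Y)"
    unfolding C_tau_open_def by (intro conjI ballI exI[of _ "{}"]) auto
  then have "cmaps X Y \<subseteq> topspace (C_tau \<tau> X Y)"
    unfolding openin_C_tau[OF \<tau>, symmetric] by (rule openin_subset)
  moreover have "C_tau_open \<tau> X Y (topspace (C_tau \<tau> X Y))"
    unfolding openin_C_tau[OF \<tau>, symmetric] by (rule openin_topspace)
  ultimately show ?thesis
    by (simp add: C_tau_open_def subset_antisym)
qed

definition Z_tau_set :: "'i rel \<Rightarrow> 'a topology \<Rightarrow> 'a set \<Rightarrow> bool" where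
  "Z_tau_set \<tau> X A \<longleftrightarrow> closedin X A \<and>
     C_tau \<tau> X X closure_of {f \<in> cmaps X X. f ` topspace X \<inter> A = {}} = topspace (C_tau \<tau> X X)"

end

theory Submission
  imports Defs
begin

text \<open>
  Write $Q = I^\tau$ and $R = \beta X \setminus X$; as $X$ is locally compact, $R$ is closed in
  $\beta X$. The proof compares proper maps from $X$ to $Q \setminus L$ with maps
  $G : \beta X \to Q$ such that $G^{-1}(L) = R$. Restricting such a $G$ to $X$ gives a proper map
  (\<open>compact_proper_map_off_remainder\<close>), and conversely the extension of a proper map to $\beta X$
  sends $R$ into $L$, since a point of $R$ with value outside $L$ would be a limit of a compact
  subset of $X$ (\<open>compact_proper_map_limits\<close>). So a map $R \to L$ is the boundary
  value of a proper map as soon as an extension of it over $\beta X$ can be freed from meeting $L$ on $X$.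

  That is what the $Z_\tau$-condition provides (\<open>push_off_compacta\<close>): if $Z$ is compact, $B$ is
  closed in $Z$, and a map $g : Z \to Q$ misses $L$ on $B \cap \bigcup \mathcal{K}$, where
  $\mathcal{K}$ consists of at most $\tau$ compacta, then $g$ can be changed outside $B$ so that it
  misses $L$ on all of $\bigcup \mathcal{K}$. One compactum $K$ is handled by interpolating linearly
  between $g$ and $r \circ g$, where $r : Q \to Q \setminus L$ is so close to the identity on suitable
  coordinates that the intermediate points are harmless near $B \cap K$. All of
  $\mathcal{K}$ is handled one compactum at a time. That $g(K)$ misses $L$ is witnessed by finitely
  many coordinates, which later steps must respect. If $\tau$ is uncountable, fewer
  than $\tau$ coordinates can be preserved exactly, so a transfinite recursion freezes finitely many
  new coordinates at each stage and there is nothing to do at limits. If $\tau$ is countable,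
  coordinates are only preserved up to an error, and the result is a uniform limit of a sequence with
  rapidly decreasing errors.

  Assume $L \in \mathrm{AE}(R)$ and let $f : A \to Q \setminus L$ be proper on a closed $C^*$-embedded
  set. Extend $f$ to $\beta X \to Q$; it sends
  $\overline{A} \setminus X$ into $L$, and this part extends to a map $R \to L$. The two maps
  agree on $\overline{A} \cap R$, hence define a map on $B = \overline{A} \cup R$, which extends to
  $\beta X \to Q$; pushing the compacta that cover $X$ off $L$ relative to $B$ gives the extension of $f$.

  Assume $Q \setminus L \in \mathrm{AE}_p(X)$ and let $f : A \to L$ be a map on a closed $A \subseteq R$.
  Since $L$ is an ANR, $f$ extends to a map $S \to L$ on the closure $S$ of an open neighbourhood of $A$
  in $\beta X$. Pushing $S \cap X$ off $L$ relative to $S \cap R$ turns it into a proper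
  map from $S \cap X$ to $Q \setminus L$. The set $S \cap X$ is regular closed, hence
  $C^*$-embedded, so this proper map extends over $X$, and the boundary values on $R$ of the extension
  extend $f$.
\<close>

section \<open>Coordinates and boxes in the Tychonov cube\<close>

lemma in_Tychonov_cube:
  "x \<in> topspace (Tychonov_cube \<tau>) \<longleftrightarrow>
     x \<in> extensional (Field \<tau>) \<and> (\<forall>i\<in>Field \<tau>. 0 \<le> x i \<and> x i \<le> 1)"
  by (auto simp: Tychonov_cube_def PiE_iff)

lemma continuous_map_into_cube:
  "continuous_map Z (Tychonov_cube \<tau>) k \<longleftrightarrow>
     (\<forall>z\<in>topspace Z. k z \<in> topspace (Tychonov_cube \<tau>)) \<and>
     (\<forall>i\<in>Field \<tau>. continuous_map Z euclideanreal (\<lambda>z. k z i))" (is "?l \<longleftrightarrow> ?r")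
proof
  assume l: ?l
  then have "\<forall>z\<in>topspace Z. k z \<in> topspace (Tychonov_cube \<tau>)"
    by (auto simp: continuous_map_def)
  with l show ?r
    by (auto simp: Tychonov_cube_def continuous_map_componentwise continuous_map_in_subtopology)
next
  assume ?r
  then show ?l
    by (fastforce simp: Tychonov_cube_def continuous_map_componentwise continuous_map_in_subtopology PiE_iff)
qed

lemma continuous_map_cube_coordinate:
  "i \<in> Field \<tau> \<Longrightarrow> continuous_map (Tychonov_cube \<tau>) euclideanreal (\<lambda>x. x i)"
  using continuous_map_into_cube[of "Tychonov_cube \<tau>" \<tau> id] by auto

lemma compact_space_cube: "compact_space (Tychonov_cube \<tau>)"
  by (simp add: Tychonov_cube_def compact_Hausdorff_unit_cube)

lemma Hausdorff_space_cube: "Hausdorff_space (Tychonov_cube \<tau>)"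
  by (simp add: Tychonov_cube_def compact_Hausdorff_unit_cube)

lemma openin_cube_box:
  assumes "finite F" "F \<subseteq> Field \<tau>"
  shows "openin (Tychonov_cube \<tau>) {x \<in> topspace (Tychonov_cube \<tau>). \<forall>i\<in>F. \<bar>x i - y i\<bar> < e}"
  using assms
proof (induction F)
  case empty
  then show ?case by simp
next
  case (insert j F)
  have "openin (Tychonov_cube \<tau>) {x \<in> topspace (Tychonov_cube \<tau>). x j \<in> {y j - e<..<y j + e}}"
    using insert.prems by (intro openin_continuous_map_preimage[OF continuous_map_cube_coordinate]) auto
  moreover have "{x \<in> topspace (Tychonov_cube \<tau>). \<forall>i\<in>insert j F. \<bar>x i - y i\<bar> < e} =
      {x \<in> topspace (Tychonov_cube \<tau>). x j \<in> {y j - e<..<y j + e}} \<inter>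
      {x \<in> topspace (Tychonov_cube \<tau>). \<forall>i\<in>F. \<bar>x i - y i\<bar> < e}"
    by (auto simp: abs_less_iff)
  ultimately show ?case using insert by (auto intro: openin_Int)
qed

lemma cube_box_nbhd:
  assumes W: "openin (Tychonov_cube \<tau>) W" and y: "y \<in> W"
  obtains F e where "finite F" "F \<subseteq> Field \<tau>" "e > 0"
    "\<And>x. x \<in> topspace (Tychonov_cube \<tau>) \<Longrightarrow> (\<And>i. i \<in> F \<Longrightarrow> \<bar>x i - y i\<bar> < e) \<Longrightarrow> x \<in> W"
proof -
  obtain U where U: "finite {i \<in> Field \<tau>. U i \<noteq> {0..1}}"
      "\<And>i. i \<in> Field \<tau> \<Longrightarrow> openin (top_of_set {0..1}) (U i)"
      "y \<in> Pi\<^sub>E (Field \<tau>) U" "Pi\<^sub>E (Field \<tau>) U \<subseteq> W"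
    using W y unfolding Tychonov_cube_def openin_product_topology_alt by fastforce
  define F where "F = {i \<in> Field \<tau>. U i \<noteq> {0..1}}"
  have "\<exists>d>0. \<forall>t\<in>{0..1}. \<bar>t - y i\<bar> < d \<longrightarrow> t \<in> U i" if "i \<in> F" for i
  proof -
    have "openin (top_of_set {0..1}) (U i)" "y i \<in> U i"
      using that U(2,3) by (auto simp: F_def PiE_iff)
    then obtain d where "d > 0" "ball (y i) d \<inter> {0..1} \<subseteq> U i"
      by (auto simp: openin_contains_ball)
    then show ?thesis by (intro exI[of _ d]) (auto simp: dist_real_def abs_minus_commute subset_iff)
  qed
  then obtain d where d: "\<And>i. i \<in> F \<Longrightarrow> d i > 0"
      "\<And>i t. i \<in> F \<Longrightarrow> t \<in> {0..1} \<Longrightarrow> \<bar>t - y i\<bar> < d i \<Longrightarrow> t \<in> U i"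
    by metis
  have F: "finite F" using U(1) by (simp add: F_def)
  define e where "e = Min (insert 1 (d ` F))"
  have e: "e > 0" "\<And>i. i \<in> F \<Longrightarrow> e \<le> d i"
    using F d(1) by (auto simp: e_def)
  show thesis
  proof (rule that[of F e])
    show "finite F" "F \<subseteq> Field \<tau>" "e > 0" using F e by (auto simp: F_def)
    fix x assume x: "x \<in> topspace (Tychonov_cube \<tau>)" "\<And>i. i \<in> F \<Longrightarrow> \<bar>x i - y i\<bar> < e"
    have "x i \<in> U i" if i: "i \<in> Field \<tau>" for i
    proof (cases "i \<in> F")
      case True
      then show ?thesis using d(2)[OF True, of "x i"] x e(2)[OF True] i
        by (fastforce simp: in_Tychonov_cube)
    next
      case False
      then show ?thesis using x(1) i by (auto simp: in_Tychonov_cube F_def)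
    qed
    then have "x \<in> Pi\<^sub>E (Field \<tau>) U" using x(1) by (auto simp: in_Tychonov_cube PiE_iff)
    then show "x \<in> W" using U(4) by blast
  qed
qed

text \<open>That a compactum misses $L$ is decided, with a positive margin, by finitely many coordinates.
  All later constructions remember only these coordinates and the margin.\<close>

lemma compact_closed_robustly_disjoint:
  assumes C: "compactin (Tychonov_cube \<tau>) C" and L: "closedin (Tychonov_cube \<tau>) L"
    and CL: "C \<inter> L = {}"
  obtains F e where "finite F" "F \<subseteq> Field \<tau>" "e > 0"
    "\<And>x y. y \<in> C \<Longrightarrow> x \<in> topspace (Tychonov_cube \<tau>) \<Longrightarrow> (\<And>i. i \<in> F \<Longrightarrow> \<bar>x i - y i\<bar> < e) \<Longrightarrow> x \<notin> L"
proof -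
  let ?Q = "Tychonov_cube \<tau>"
  have CQ: "C \<subseteq> topspace ?Q" using C by (rule compactin_subset_topspace)
  have "openin ?Q (topspace ?Q - L)" using L by (simp add: openin_diff)
  then have "\<exists>p. finite (fst p) \<and> fst p \<subseteq> Field \<tau> \<and> snd p > 0 \<and>
      (\<forall>x\<in>topspace ?Q. (\<forall>i\<in>fst p. \<bar>x i - y i\<bar> < 2 * snd p) \<longrightarrow> x \<notin> L)" if "y \<in> C" for y
  proof -
    have "y \<in> topspace ?Q - L" using CQ CL that by auto
    from cube_box_nbhd[OF \<open>openin ?Q (topspace ?Q - L)\<close> this] obtain F e where
      "finite F" "F \<subseteq> Field \<tau>" "e > 0"
      "\<And>x. x \<in> topspace ?Q \<Longrightarrow> (\<And>i. i \<in> F \<Longrightarrow> \<bar>x i - y i\<bar> < e) \<Longrightarrow> x \<in> topspace ?Q - L" by blast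
    then show ?thesis by (intro exI[of _ "(F, e/2)"]) auto
  qed
  then obtain p where p: "\<And>y. y \<in> C \<Longrightarrow> finite (fst (p y))" "\<And>y. y \<in> C \<Longrightarrow> fst (p y) \<subseteq> Field \<tau>"
      "\<And>y. y \<in> C \<Longrightarrow> snd (p y) > 0"
      "\<And>y x. y \<in> C \<Longrightarrow> x \<in> topspace ?Q \<Longrightarrow> (\<forall>i\<in>fst (p y). \<bar>x i - y i\<bar> < 2 * snd (p y)) \<Longrightarrow> x \<notin> L"
    by metis
  define W where "W = (\<lambda>y. {x \<in> topspace ?Q. \<forall>i\<in>fst (p y). \<bar>x i - y i\<bar> < snd (p y)})"
  have "openin ?Q (W y)" if "y \<in> C" for y
    unfolding W_def by (rule openin_cube_box) (use p that in auto)
  moreover have "C \<subseteq> \<Union> (W ` C)" using p(3) CQ by (fastforce simp: W_def)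
  ultimately obtain \<F> where \<F>: "finite \<F>" "\<F> \<subseteq> W ` C" "C \<subseteq> \<Union>\<F>"
    using compactinD[OF C, of "W ` C"] by auto
  from finite_subset_image[OF \<F>(1,2)] \<F>(3)
  obtain D where D: "finite D" "D \<subseteq> C" "C \<subseteq> \<Union> (W ` D)" by blast
  \<comment> \<open>The boxes that cover \<open>C\<close> have half the radius of those known to miss \<open>L\<close>; the triangle inequality
    then gives one margin for all points of \<open>C\<close>.\<close>
  define e where "e = Min (insert 1 (snd ` p ` D))"
  have e: "e > 0" "\<And>y. y \<in> D \<Longrightarrow> e \<le> snd (p y)"
    using D p(3) by (auto simp: e_def)
  show thesis
  proof (rule that[of "\<Union>y\<in>D. fst (p y)" e])
    show "finite (\<Union>y\<in>D. fst (p y))" "(\<Union>y\<in>D. fst (p y)) \<subseteq> Field \<tau>" "e > 0"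
      using D(1) p(1,2) e(1) subsetD[OF D(2)] by blast+
    fix x y assume y: "y \<in> C" and x: "x \<in> topspace ?Q"
      and xy: "\<And>i. i \<in> (\<Union>y\<in>D. fst (p y)) \<Longrightarrow> \<bar>x i - y i\<bar> < e"
    obtain c where c: "c \<in> D" "y \<in> W c" using D(3) y by auto
    have "\<bar>x i - c i\<bar> < 2 * snd (p c)" if "i \<in> fst (p c)" for i
    proof -
      have "\<bar>x i - y i\<bar> < e" using xy c(1) that by auto
      moreover have "\<bar>y i - c i\<bar> < snd (p c)" using c(2) that by (auto simp: W_def)
      ultimately show ?thesis using e(2)[OF c(1)] by argo
    qed
    then show "x \<notin> L" using p(4)[of c x] c(1) D(2) x by auto
  qed
qed

section \<open>Maps of the cube that miss a $Z_\tau$-set\<close>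

text \<open>The \<open>Z\<^sub>\<tau>\<close>-condition in coordinates. If $\tau$ is uncountable, \<open>T\<close> may contain, for fewer than
  $\tau$ coordinates, all tolerances \<open>1 / n\<close>, so that \<open>r\<close> preserves these coordinates exactly. If $\tau$
  is countable, \<open>T\<close> is finite and the coordinates are only preserved approximately.

  The maps that satisfy the tolerances form a neighbourhood of the identity. The bound \<open>d < e\<close>,
  uniform in \<open>x\<close>, makes that set open: there is room left for a cover by intervals of length
  proportional to \<open>e - d\<close>. Rational centres keep these covers countable.\<close>

lemma Z_tau_set_approx:
  fixes \<tau> :: "'i rel"
  assumes \<tau>: "Cinfinite \<tau>" and Z: "Z_tau_set \<tau> (Tychonov_cube \<tau>) L"
    and T: "T \<subseteq> Field \<tau> \<times> {0<..}" "|T| <o \<tau>"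
  obtains r where "continuous_map (Tychonov_cube \<tau>) (Tychonov_cube \<tau>) r"
    and "\<And>x. x \<in> topspace (Tychonov_cube \<tau>) \<Longrightarrow> r x \<notin> L"
    and "\<And>i e x. (i, e) \<in> T \<Longrightarrow> x \<in> topspace (Tychonov_cube \<tau>) \<Longrightarrow> \<bar>r x i - x i\<bar> < e"
proof -
  let ?Q = "Tychonov_cube \<tau>"
  define G where "G = {g \<in> cmaps ?Q ?Q. \<forall>(i, e)\<in>T. \<exists>d<e. \<forall>x\<in>topspace ?Q. \<bar>g x i - x i\<bar> \<le> d}"
  define U where "U = (\<lambda>i d. (\<lambda>q. {x \<in> topspace ?Q. \<bar>x i - q\<bar> < d}) ` \<rat>)"
  have Ucov: "U i d \<in> cov ?Q" if i: "i \<in> Field \<tau>" and d: "d > 0" for i d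
    unfolding cov_def
  proof (intro CollectI conjI ballI)
    show "countable (U i d)" unfolding U_def by (intro countable_image countable_rat)
    show "functionally_open_in ?Q V" if V: "V \<in> U i d" for V
    proof -
      obtain q where q: "V = {x \<in> topspace ?Q. \<bar>x i - q\<bar> < d}" using V by (auto simp: U_def)
      have "continuous_map ?Q euclideanreal (\<lambda>x. max 0 (d - \<bar>x i - q\<bar>))"
        by (intro continuous_intros continuous_map_cube_coordinate i)
      moreover have "V = {x \<in> topspace ?Q. max 0 (d - \<bar>x i - q\<bar>) \<noteq> 0}"
        by (auto simp: q max_def)
      ultimately show ?thesis unfolding functionally_open_in_def by blast
    qed
    show "\<Union> (U i d) = topspace ?Q"
    proof
      show "topspace ?Q \<subseteq> \<Union> (U i d)"
      proof
        fix x assume x: "x \<in> topspace ?Q"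
        obtain q where "q \<in> \<rat>" "x i < q" "q < x i + d"
          using Rats_dense_in_real[of "x i" "x i + d"] d by auto
        with x have "x \<in> {x \<in> topspace ?Q. \<bar>x i - q\<bar> < d}" by auto
        with \<open>q \<in> \<rat>\<close> show "x \<in> \<Union> (U i d)" unfolding U_def by blast
      qed
    qed (auto simp: U_def)
  qed
  have "C_tau_open \<tau> ?Q ?Q G"
    unfolding C_tau_open_def
  proof (intro conjI ballI)
    show "G \<subseteq> cmaps ?Q ?Q" by (auto simp: G_def)
    fix h assume h: "h \<in> G"
    then have "\<forall>p\<in>T. \<exists>d<snd p. \<forall>x\<in>topspace ?Q. \<bar>h x (fst p) - x (fst p)\<bar> \<le> d"
      by (fastforce simp: G_def)
    then obtain d where d: "\<And>p. p \<in> T \<Longrightarrow> d p < snd p"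
      "\<And>p x. p \<in> T \<Longrightarrow> x \<in> topspace ?Q \<Longrightarrow> \<bar>h x (fst p) - x (fst p)\<bar> \<le> d p"
      by metis
    define \<V> where "\<V> = (\<lambda>p. U (fst p) ((snd p - d p) / 4)) ` T"
    have "\<V> \<subseteq> cov ?Q" unfolding \<V>_def using Ucov T(1) d(1) by fastforce
    moreover have "|\<V>| <o \<tau>"
      unfolding \<V>_def using card_of_image T(2) by (rule ordLeq_ordLess_trans)
    moreover have "g \<in> G" if g: "g \<in> cmaps ?Q ?Q" and cl: "\<forall>\<U>\<in>\<V>. close_maps ?Q \<U> g h" for g
    proof -
      have "\<exists>d<e. \<forall>x\<in>topspace ?Q. \<bar>g x i - x i\<bar> \<le> d" if p: "(i, e) \<in> T" for i e
      proof (intro exI[of _ "(e + d (i, e)) / 2"] conjI ballI)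
        show "(e + d (i, e)) / 2 < e" using d(1)[OF p] by simp
        fix x assume x: "x \<in> topspace ?Q"
        have "close_maps ?Q (U i ((e - d (i, e)) / 4)) g h"
          using cl p by (force simp: \<V>_def)
        then obtain q where "\<bar>g x i - q\<bar> < (e - d (i, e)) / 4" "\<bar>h x i - q\<bar> < (e - d (i, e)) / 4"
          using x by (auto simp: close_maps_def U_def)
        moreover have "\<bar>h x i - x i\<bar> \<le> d (i, e)" using d(2)[OF p x] by simp
        ultimately show "\<bar>g x i - x i\<bar> \<le> (e + d (i, e)) / 2" by argo
      qed
      with g show ?thesis by (auto simp: G_def)
    qed
    ultimately show "\<exists>\<V>\<subseteq>cov ?Q. |\<V>| <o \<tau> \<and>
        (\<forall>g\<in>cmaps ?Q ?Q. (\<forall>\<U>\<in>\<V>. close_maps ?Q \<U> g h) \<longrightarrow> g \<in> G)"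
      by blast
  qed
  then have oG: "openin (C_tau \<tau> ?Q ?Q) G" by (simp add: openin_C_tau[OF \<tau>])
  let ?id = "restrict id (topspace ?Q)"
  have "continuous_map ?Q ?Q ?id"
    by (rule continuous_map_eq[OF continuous_map_id]) auto
  then have "?id \<in> cmaps ?Q ?Q" by (simp add: cmaps_def)
  then have idG: "?id \<in> G" using T(1) by (fastforce simp: G_def)
  then have "?id \<in> C_tau \<tau> ?Q ?Q closure_of {f \<in> cmaps ?Q ?Q. f ` topspace ?Q \<inter> L = {}}"
    using Z openin_subset[OF oG] by (auto simp: Z_tau_set_def)
  then obtain r where r: "r \<in> G" "r \<in> cmaps ?Q ?Q" "r ` topspace ?Q \<inter> L = {}"
    using oG idG unfolding in_closure_of by blast
  show thesis
  proof (rule that)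
    show "continuous_map ?Q ?Q r" using r(2) by (simp add: cmaps_def)
    show "r x \<notin> L" if "x \<in> topspace ?Q" for x using r(3) that by auto
    show "\<bar>r x i - x i\<bar> < e" if "(i, e) \<in> T" "x \<in> topspace ?Q" for i e x
      using r(1) that by (fastforce simp: G_def)
  qed
qed

text \<open>Replacing \<open>g\<close> by \<open>r \<circ> g\<close> outright would change it on \<open>B\<close>. Hence the change is faded in by a
  Urysohn function \<open>l\<close> that vanishes on \<open>B\<close>. On \<open>K\<close> this is dangerous only where \<open>l < 1\<close>; that
  region is kept inside a neighbourhood \<open>V\<close> of \<open>K \<inter> B\<close> where \<open>g\<close> has a positive margin to \<open>L\<close>, and
  \<open>r\<close> is chosen to respect that margin in addition to the tolerances \<open>T\<close>.\<close>

lemma push_off_one_compactum: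
  fixes \<tau> :: "'i rel"
  assumes \<tau>: "Cinfinite \<tau>" and L: "Z_tau_set \<tau> (Tychonov_cube \<tau>) L"
    and Z: "compact_space Z" "Hausdorff_space Z" and B: "closedin Z B" and K: "closedin Z K"
    and g: "continuous_map Z (Tychonov_cube \<tau>) g" and gKB: "\<And>x. x \<in> K \<inter> B \<Longrightarrow> g x \<notin> L"
    and T: "T \<subseteq> Field \<tau> \<times> {0<..}" "|T| <o \<tau>"
  obtains g' where "continuous_map Z (Tychonov_cube \<tau>) g'" "\<And>x. x \<in> B \<Longrightarrow> g' x = g x"
    "\<And>x. x \<in> K \<Longrightarrow> g' x \<notin> L"
    "\<And>i e x. (i, e) \<in> T \<Longrightarrow> x \<in> topspace Z \<Longrightarrow> \<bar>g' x i - g x i\<bar> < e"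
proof -
  let ?Q = "Tychonov_cube \<tau>"
  have Lc: "closedin ?Q L" using L by (simp add: Z_tau_set_def)
  have nQ: "normal_space ?Q"
    using compact_space_cube Hausdorff_space_cube compact_Hausdorff_or_regular_imp_normal_space by blast
  have nZ: "normal_space Z" using Z compact_Hausdorff_or_regular_imp_normal_space by blast
  have KZ: "K \<subseteq> topspace Z" and BZ: "B \<subseteq> topspace Z" using K B closedin_subset by blast+
  have gQ: "g x \<in> topspace ?Q" if "x \<in> topspace Z" for x
    using g that by (auto simp: continuous_map_into_cube)
  have "compactin Z (K \<inter> B)" using Z(1) K B by (intro closedin_compact_space closedin_Int)
  then have "compactin ?Q (g ` (K \<inter> B))" using g by (rule image_compactin)
  then have "closedin ?Q (g ` (K \<inter> B))" using Hausdorff_space_cube compactin_imp_closedin by blast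
  moreover have "openin ?Q (topspace ?Q - L)" using Lc by (simp add: openin_diff)
  moreover have "g ` (K \<inter> B) \<subseteq> topspace ?Q - L" using gKB gQ KZ by auto
  ultimately obtain W where W: "openin ?Q W" "g ` (K \<inter> B) \<subseteq> W" "?Q closure_of W \<subseteq> topspace ?Q - L"
    using nQ unfolding normal_space_alt by meson
  have "compactin ?Q (?Q closure_of W)" by (simp add: closedin_compact_space compact_space_cube)
  then obtain F e0 where F: "finite F" "F \<subseteq> Field \<tau>" "e0 > 0"
    "\<And>x y. y \<in> ?Q closure_of W \<Longrightarrow> x \<in> topspace ?Q \<Longrightarrow> (\<And>i. i \<in> F \<Longrightarrow> \<bar>x i - y i\<bar> < e0) \<Longrightarrow> x \<notin> L"
    using compact_closed_robustly_disjoint[of \<tau> "?Q closure_of W" L] Lc W(3) by blast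
  have "|F \<times> {e0}| <o \<tau>"
    using \<tau> F(1) by (intro Cfinite_ordLess_Cinfinite) (simp_all add: cfinite_def Field_card_of card_of_card_order_on)
  then have "|T \<union> F \<times> {e0}| <o \<tau>" using T(2) \<tau> by (intro Un_Cinfinite_bound_strict)
  then obtain r where r: "continuous_map ?Q ?Q r" "\<And>x. x \<in> topspace ?Q \<Longrightarrow> r x \<notin> L"
    "\<And>i e x. (i, e) \<in> T \<union> F \<times> {e0} \<Longrightarrow> x \<in> topspace ?Q \<Longrightarrow> \<bar>r x i - x i\<bar> < e"
    using Z_tau_set_approx[OF \<tau> L, of "T \<union> F \<times> {e0}"] T(1) F(2,3) by auto
  define V where "V = {x \<in> topspace Z. g x \<in> W}"
  have V: "openin Z V" unfolding V_def using g W(1) by (rule openin_continuous_map_preimage)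
  have "closedin Z (K - V)" using K V by (rule closedin_diff)
  moreover have "disjnt B (K - V)" using W(2) BZ by (auto simp: V_def disjnt_def)
  ultimately obtain l where l: "continuous_map Z (top_of_set {0..1::real}) l" "l ` B \<subseteq> {0}" "l ` (K - V) \<subseteq> {1}"
    using Urysohn_lemma[OF nZ B, of "K - V" 0 1] by auto
  have l01: "0 \<le> l x \<and> l x \<le> 1" if "x \<in> topspace Z" for x
    using l(1) that by (auto simp: continuous_map_in_subtopology)
  have lc: "continuous_map Z euclideanreal l" using l(1) by (simp add: continuous_map_in_subtopology)
  define g' where "g' = (\<lambda>x. \<lambda>i\<in>Field \<tau>. (1 - l x) * g x i + l x * r (g x) i)"
  have rg: "continuous_map Z ?Q (\<lambda>x. r (g x))"
    using continuous_map_compose[OF g r(1)] by (simp add: o_def)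
  have ext: "g x \<in> extensional (Field \<tau>)" "r (g x) \<in> extensional (Field \<tau>)" if "x \<in> topspace Z" for x
    using g rg that by (auto simp: continuous_map_into_cube in_Tychonov_cube)
  have g'Q: "g' x \<in> topspace ?Q" if "x \<in> topspace Z" for x
  proof -
    have "0 \<le> (1 - l x) * g x i + l x * r (g x) i \<and> (1 - l x) * g x i + l x * r (g x) i \<le> 1" if "i \<in> Field \<tau>" for i
    proof -
      have *: "0 \<le> g x i" "g x i \<le> 1" "0 \<le> r (g x) i" "r (g x) i \<le> 1"
        using g rg \<open>x \<in> topspace Z\<close> that by (auto simp: continuous_map_into_cube in_Tychonov_cube)
      have "0 \<le> l x" "l x \<le> 1" using l01 \<open>x \<in> topspace Z\<close> by auto
      then show ?thesis using * convex_bound_le[of "g x i" 1 "r (g x) i" "1 - l x" "l x"] by auto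
    qed
    then show ?thesis by (auto simp: g'_def in_Tychonov_cube)
  qed
  have cont: "continuous_map Z ?Q g'"
    unfolding continuous_map_into_cube
  proof (intro conjI ballI)
    show "g' x \<in> topspace ?Q" if "x \<in> topspace Z" for x using g'Q that .
    fix i assume i: "i \<in> Field \<tau>"
    have "continuous_map Z euclideanreal (\<lambda>x. g x i)" "continuous_map Z euclideanreal (\<lambda>x. r (g x) i)"
      using g rg i by (auto simp: continuous_map_into_cube)
    then have "continuous_map Z euclideanreal (\<lambda>x. (1 - l x) * g x i + l x * r (g x) i)"
      by (intro continuous_intros lc)
    then show "continuous_map Z euclideanreal (\<lambda>z. g' z i)" using i by (simp add: g'_def)
  qed
  have diff: "\<bar>g' x i - g x i\<bar> < e" if "(i, e) \<in> T \<union> F \<times> {e0}" "x \<in> topspace Z" for i e x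
  proof -
    have i: "i \<in> Field \<tau>" using that T(1) F(2) by auto
    have "g' x i - g x i = l x * (r (g x) i - g x i)" using i by (simp add: g'_def algebra_simps)
    then have "\<bar>g' x i - g x i\<bar> = l x * \<bar>r (g x) i - g x i\<bar>" using l01 that(2) by (simp add: abs_mult)
    also have "\<dots> \<le> \<bar>r (g x) i - g x i\<bar>" using l01[OF that(2)] by (simp add: mult_left_le_one_le)
    also have "\<dots> < e" using r(3)[OF that(1) gQ[OF that(2)]] .
    finally show ?thesis .
  qed
  show thesis
  proof (rule that[OF cont])
    show "g' x = g x" if "x \<in> B" for x
    proof -
      have "l x = 0" using l(2) that by auto
      then show ?thesis using ext(1)[of x] BZ that by (auto simp: g'_def extensional_def fun_eq_iff)
    qed
    show "g' x \<notin> L" if x: "x \<in> K" for x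
    proof (cases "x \<in> V")
      case True
      then have "g x \<in> ?Q closure_of W"
        using W(1) closure_of_subset[of W ?Q] openin_subset by (auto simp: V_def)
      then show ?thesis using F(4)[of "g x" "g' x"] diff g'Q x KZ by blast
    next
      case False
      then have "l x = 1" using l(3) x by auto
      then have "g' x = r (g x)" using ext(2)[of x] KZ x by (auto simp: g'_def extensional_def fun_eq_iff)
      then show ?thesis using r(2)[OF gQ] x KZ by auto
    qed
    show "\<bar>g' x i - g x i\<bar> < e" if "(i, e) \<in> T" "x \<in> topspace Z" for i e x using diff that by blast
  qed
qed

section \<open>Pushing many compacta off a $Z_\tau$-set\<close>

text \<open>A map into the cube can be built coordinate by coordinate. In the transfinite recursion below
  this replaces any limit argument: a frozen coordinate is read off from a stage that froze it, every
  other one from the initial map \<open>g\<close>.\<close>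

lemma glue_coordinates:
  assumes g: "continuous_map Z (Tychonov_cube \<tau>) g"
    and k: "\<And>u. u \<in> S \<Longrightarrow> continuous_map Z (Tychonov_cube \<tau>) (k u)"
    and kg: "\<And>u x. u \<in> S \<Longrightarrow> x \<in> B \<Longrightarrow> k u x = g x" and B: "B \<subseteq> topspace Z"
    and F: "\<And>u. u \<in> S \<Longrightarrow> F u \<subseteq> Field \<tau>"
    and con: "\<And>u v i x. u \<in> S \<Longrightarrow> v \<in> S \<Longrightarrow> i \<in> F u \<Longrightarrow> i \<in> F v \<Longrightarrow> x \<in> topspace Z \<Longrightarrow> k u x i = k v x i"
  obtains h where "continuous_map Z (Tychonov_cube \<tau>) h" "\<And>x. x \<in> B \<Longrightarrow> h x = g x"
    "\<And>u i x. u \<in> S \<Longrightarrow> i \<in> F u \<Longrightarrow> x \<in> topspace Z \<Longrightarrow> h x i = k u x i"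
proof -
  let ?Q = "Tychonov_cube \<tau>"
  define w where "w i = (SOME u. u \<in> S \<and> i \<in> F u)" for i
  have w: "w i \<in> S \<and> i \<in> F (w i)" if "u \<in> S" "i \<in> F u" for u i
    unfolding w_def by (rule someI[of _ u]) (use that in auto)
  define h where "h = (\<lambda>x. \<lambda>i\<in>Field \<tau>. if \<exists>u\<in>S. i \<in> F u then k (w i) x i else g x i)"
  have gQ: "\<And>x. x \<in> topspace Z \<Longrightarrow> g x \<in> topspace ?Q"
    and kQ: "\<And>u x. u \<in> S \<Longrightarrow> x \<in> topspace Z \<Longrightarrow> k u x \<in> topspace ?Q"
    using g k by (auto simp: continuous_map_into_cube)
  have gc: "\<And>i. i \<in> Field \<tau> \<Longrightarrow> continuous_map Z euclideanreal (\<lambda>x. g x i)"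
    and kc: "\<And>u i. u \<in> S \<Longrightarrow> i \<in> Field \<tau> \<Longrightarrow> continuous_map Z euclideanreal (\<lambda>x. k u x i)"
    using g k by (auto simp: continuous_map_into_cube)
  show thesis
  proof (rule that)
    show "continuous_map Z ?Q h"
      unfolding continuous_map_into_cube
    proof (intro conjI ballI)
      show "h x \<in> topspace ?Q" if "x \<in> topspace Z" for x
        using gQ[OF that] kQ[OF _ that] w unfolding in_Tychonov_cube h_def by auto
      show "continuous_map Z euclideanreal (\<lambda>x. h x i)" if i: "i \<in> Field \<tau>" for i
      proof (cases "\<exists>u\<in>S. i \<in> F u")
        case True
        then have "w i \<in> S" using w by auto
        then have "continuous_map Z euclideanreal (\<lambda>x. k (w i) x i)" using kc i by blast
        then show ?thesis using True i by (simp add: h_def)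
      next
        case False
        then show ?thesis using gc i by (simp add: h_def)
      qed
    qed
    show "h x = g x" if "x \<in> B" for x
    proof -
      have "g x \<in> extensional (Field \<tau>)" using gQ[of x] B that by (auto simp: in_Tychonov_cube)
      then show ?thesis using kg[OF _ that] w by (auto simp: h_def extensional_def fun_eq_iff)
    qed
    show "h x i = k u x i" if "u \<in> S" "i \<in> F u" "x \<in> topspace Z" for u i x
    proof -
      have "i \<in> Field \<tau>" using F that by blast
      then have "h x i = k (w i) x i" using that by (auto simp: h_def)
      also have "\<dots> = k u x i" using con[of "w i" u i x] w[OF that(1,2)] that by blast
      finally show ?thesis .
    qed
  qed
qed

text \<open>Before any stage of the recursion fewer than \<open>\<tau>\<close> coordinates are frozen, and asking for exact
  equality on them costs a countable factor, which an uncountable \<open>\<tau>\<close> absorbs.\<close>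

lemma card_UN_finite_times_nat:
  fixes \<tau> :: "'i rel"
  assumes \<tau>: "Cinfinite \<tau>" and unc: "uncountable (Field \<tau>)"
    and I: "|I| <o \<tau>" and F: "\<And>u. u \<in> I \<Longrightarrow> finite (F u)"
  shows "|(\<Union>u\<in>I. F u) \<times> (UNIV :: nat set)| <o \<tau>"
proof (cases "finite I")
  case True
  then have "countable ((\<Union>u\<in>I. F u) \<times> (UNIV :: nat set))" using F by (auto intro: countable_finite)
  then have le: "|(\<Union>u\<in>I. F u) \<times> (UNIV :: nat set)| \<le>o |UNIV :: nat set|"
    unfolding card_of_ordLeq[symmetric] countable_def by simp
  have "\<not> |Field \<tau>| \<le>o |UNIV :: nat set|"
  proof
    assume "|Field \<tau>| \<le>o |UNIV :: nat set|"
    then have "\<exists>f :: 'i \<Rightarrow> nat. inj_on f (Field \<tau>)" unfolding card_of_ordLeq[symmetric] by auto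
    with unc show False by (simp add: countable_def)
  qed
  then have "|UNIV :: nat set| <o |Field \<tau>|"
    by (simp add: not_ordLeq_iff_ordLess[OF card_of_Well_order card_of_Well_order])
  moreover have "|Field \<tau>| =o \<tau>" using \<tau> by (simp add: card_of_Field_ordIso)
  ultimately have "|UNIV :: nat set| <o \<tau>" by (rule ordLess_ordIso_trans)
  with le show ?thesis by (rule ordLeq_ordLess_trans)
next
  case False
  have "|\<Union>u\<in>I. F u| \<le>o |I|"
  proof (rule card_of_UNION_ordLeq_infinite[OF False])
    show "|I| \<le>o |I|" by (rule card_of_mono1) simp
    show "\<forall>u\<in>I. |F u| \<le>o |I|"
    proof
      fix u assume "u \<in> I"
      then have "\<not> |I| \<le>o |F u|" using F False card_of_ordLeq_infinite by auto
      then show "|F u| \<le>o |I|"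
        using ordLeq_total[OF card_of_Well_order card_of_Well_order, of I "F u"] by simp
    qed
  qed
  moreover have "|UNIV :: nat set| \<le>o |I|"
    using False by (simp add: infinite_iff_card_of_nat)
  ultimately have "|(\<Union>u\<in>I. F u) \<times> (UNIV :: nat set)| \<le>o |I|"
    using False by (intro card_of_Sigma_ordLeq_infinite) auto
  then show ?thesis using I by (rule ordLeq_ordLess_trans)
qed

text \<open>Recursion along the well-order \<open>\<tau>\<close>. Stage \<open>t\<close> yields a finite set of coordinates to freeze and
  a map that agrees with all earlier stages on the coordinates they froze. Its frozen
  coordinates certify that the image of \<open>K t\<close> misses \<open>L\<close>, so every map with these coordinates, in
  particular the final one, misses \<open>L\<close> on \<open>K t\<close>.\<close>

lemma push_off_uncountable:
  fixes \<tau> :: "'i rel"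
  assumes \<tau>: "Cinfinite \<tau>" and unc: "uncountable (Field \<tau>)" and L: "Z_tau_set \<tau> (Tychonov_cube \<tau>) L"
    and Z: "compact_space Z" "Hausdorff_space Z" and B: "closedin Z B"
    and K: "\<And>t. t \<in> Field \<tau> \<Longrightarrow> closedin Z (K t)"
    and g: "continuous_map Z (Tychonov_cube \<tau>) g"
    and gKB: "\<And>t x. t \<in> Field \<tau> \<Longrightarrow> x \<in> K t \<inter> B \<Longrightarrow> g x \<notin> L"
  shows "\<exists>G. continuous_map Z (Tychonov_cube \<tau>) G \<and> (\<forall>x\<in>B. G x = g x) \<and> (\<forall>t\<in>Field \<tau>. \<forall>x\<in>K t. G x \<notin> L)"
proof -
  let ?Q = "Tychonov_cube \<tau>"
  have Lc: "closedin ?Q L" using L by (simp add: Z_tau_set_def)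
  have BZ: "B \<subseteq> topspace Z" using B closedin_subset by blast
  have KZ: "\<And>t x. t \<in> Field \<tau> \<Longrightarrow> x \<in> K t \<Longrightarrow> x \<in> topspace Z" using K closedin_subset by blast
  define P where "P = (\<lambda>s t p. t \<in> Field \<tau> \<longrightarrow>
     continuous_map Z ?Q (snd p) \<and> (\<forall>x\<in>B. snd p x = g x) \<and>
     finite (fst p) \<and> fst p \<subseteq> Field \<tau> \<and>
     (\<forall>x\<in>K t. \<forall>y\<in>topspace ?Q. (\<forall>i\<in>fst p. y i = snd p x i) \<longrightarrow> y \<notin> L) \<and>
     (\<forall>u\<in>underS \<tau> t. \<forall>i\<in>fst (s u). \<forall>x\<in>topspace Z. snd p x i = snd (s u) x i))"
  have wo: "Well_order \<tau>" using \<tau> by (simp add: card_order_on_well_order_on)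
  have tot: "u = v \<or> u \<in> underS \<tau> v \<or> v \<in> underS \<tau> u" if "u \<in> Field \<tau>" "v \<in> Field \<tau>" for u v
    using wo that unfolding well_order_on_def linear_order_on_def total_on_def underS_def by blast
  have con: "snd (s u) x i = snd (s v) x i"
    if s: "\<And>t. t \<in> A \<Longrightarrow> P s t (s t)" and A: "A \<subseteq> Field \<tau>" and u: "u \<in> A" "i \<in> fst (s u)"
      and v: "v \<in> A" "i \<in> fst (s v)" and x: "x \<in> topspace Z"
    for s :: "'i \<Rightarrow> 'i set \<times> ('a \<Rightarrow> 'i \<Rightarrow> real)" and A u v i x
  proof -
    have uv: "u \<in> Field \<tau>" "v \<in> Field \<tau>" using A u v by auto
    have "\<forall>t\<in>underS \<tau> v. \<forall>i\<in>fst (s t). \<forall>x\<in>topspace Z. snd (s v) x i = snd (s t) x i"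
      using s[OF v(1)] uv(2) by (simp add: P_def)
    moreover have "\<forall>t\<in>underS \<tau> u. \<forall>i\<in>fst (s t). \<forall>x\<in>topspace Z. snd (s u) x i = snd (s t) x i"
      using s[OF u(1)] uv(1) by (simp add: P_def)
    ultimately show ?thesis using tot[OF uv] u(2) v(2) x by metis
  qed
  have assemble: "\<exists>h. continuous_map Z ?Q h \<and> (\<forall>x\<in>B. h x = g x) \<and>
      (\<forall>u\<in>A. \<forall>i\<in>fst (s u). \<forall>x\<in>topspace Z. h x i = snd (s u) x i)"
    if s: "\<And>t. t \<in> A \<Longrightarrow> P s t (s t)" and A: "A \<subseteq> Field \<tau>"
    for s :: "'i \<Rightarrow> 'i set \<times> ('a \<Rightarrow> 'i \<Rightarrow> real)" and A
  proof (rule glue_coordinates[OF g, of A "\<lambda>u. snd (s u)" B "\<lambda>u. fst (s u)"])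
    show "continuous_map Z ?Q (snd (s u))" "fst (s u) \<subseteq> Field \<tau>" if "u \<in> A" for u
      using s[OF that] A that by (auto simp: P_def)
    show "snd (s u) x = g x" if "u \<in> A" "x \<in> B" for u x
      using s[OF that(1)] A that by (auto simp: P_def)
    show "snd (s u) x i = snd (s v) x i"
      if "u \<in> A" "v \<in> A" "i \<in> fst (s u)" "i \<in> fst (s v)" "x \<in> topspace Z" for u v i x
      using con[of A s, OF s A that(1,3,2,4,5)] .
  qed (use BZ in blast)+
  have "\<exists>s :: 'i \<Rightarrow> 'i set \<times> ('a \<Rightarrow> 'i \<Rightarrow> real). \<forall>t. P s t (s t)"
  proof (rule dependent_wf_choice[of "\<tau> - Id"])
    show "wf (\<tau> - Id)" using wo by (simp add: well_order_on_def)
    show "P f x r = P f' x r" if "\<And>z. (z, x) \<in> \<tau> - Id \<Longrightarrow> f z = f' z"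
      for f f' :: "'i \<Rightarrow> 'i set \<times> ('a \<Rightarrow> 'i \<Rightarrow> real)" and x r
    proof -
      have "\<forall>u\<in>underS \<tau> x. f u = f' u" using that by (auto simp: underS_def)
      then show ?thesis by (simp add: P_def)
    qed
    fix t :: 'i and s :: "'i \<Rightarrow> 'i set \<times> ('a \<Rightarrow> 'i \<Rightarrow> real)"
    assume "\<And>u. (u, t) \<in> \<tau> - Id \<Longrightarrow> P s u (s u)"
    then have s: "\<And>u. u \<in> underS \<tau> t \<Longrightarrow> P s u (s u)" by (auto simp: underS_def)
    show "\<exists>p. P s t p"
    proof (cases "t \<in> Field \<tau>")
      case t: True
      have US: "underS \<tau> t \<subseteq> Field \<tau>" by (auto simp: underS_def Field_def)
      obtain h where h: "continuous_map Z ?Q h" "\<And>x. x \<in> B \<Longrightarrow> h x = g x"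
        "\<And>u i x. u \<in> underS \<tau> t \<Longrightarrow> i \<in> fst (s u) \<Longrightarrow> x \<in> topspace Z \<Longrightarrow> h x i = snd (s u) x i"
        using assemble[OF s US] by blast
      define J where "J = (\<Union>u\<in>underS \<tau> t. fst (s u))"
      have fin: "finite (fst (s u))" "fst (s u) \<subseteq> Field \<tau>" if "u \<in> underS \<tau> t" for u
        using s[OF that] subsetD[OF US that] by (simp_all add: P_def)
      \<comment> \<open>Tolerance \<open>1 / n\<close> for every \<open>n\<close> forces equality on the frozen coordinates \<open>J\<close>.\<close>
      define T where "T = (\<lambda>(i, n). (i, 1 / real (Suc n))) ` (J \<times> UNIV)"
      have "|J \<times> (UNIV :: nat set)| <o \<tau>"
        unfolding J_def using \<tau> t fin
        by (intro card_UN_finite_times_nat[OF \<tau> unc] card_of_underS) auto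
      then have Tc: "|T| <o \<tau>" unfolding T_def by (rule ordLeq_ordLess_trans[OF card_of_image])
      have TF: "T \<subseteq> Field \<tau> \<times> {0<..}" using fin by (auto simp: T_def J_def)
      have hKB: "\<And>x. x \<in> K t \<inter> B \<Longrightarrow> h x \<notin> L" using gKB[OF t] h(2) by auto
      obtain k where k: "continuous_map Z ?Q k" "\<And>x. x \<in> B \<Longrightarrow> k x = h x"
        "\<And>x. x \<in> K t \<Longrightarrow> k x \<notin> L"
        "\<And>i e x. (i, e) \<in> T \<Longrightarrow> x \<in> topspace Z \<Longrightarrow> \<bar>k x i - h x i\<bar> < e"
        using push_off_one_compactum[OF \<tau> L Z B K[OF t] h(1) hKB TF Tc] by blast
      have kh: "k x i = h x i" if "i \<in> J" "x \<in> topspace Z" for i x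
      proof (rule ccontr)
        assume "k x i \<noteq> h x i"
        then obtain n where "1 / real (Suc n) < \<bar>k x i - h x i\<bar>"
          using reals_Archimedean[of "\<bar>k x i - h x i\<bar>"] by (auto simp: inverse_eq_divide)
        moreover have "(i, 1 / real (Suc n)) \<in> T" using that by (force simp: T_def)
        ultimately show False using k(4)[of i "1 / real (Suc n)" x] that by simp
      qed
      have "compactin ?Q (k ` K t)"
        using closedin_compact_space[OF Z(1) K[OF t]] k(1) by (rule image_compactin)
      moreover have "k ` K t \<inter> L = {}" using k(3) by auto
      ultimately obtain F e where F: "finite F" "F \<subseteq> Field \<tau>" "e > 0"
        "\<And>x y. y \<in> k ` K t \<Longrightarrow> x \<in> topspace ?Q \<Longrightarrow> (\<And>i. i \<in> F \<Longrightarrow> \<bar>x i - y i\<bar> < e) \<Longrightarrow> x \<notin> L"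
        using compact_closed_robustly_disjoint[of \<tau> "k ` K t" L] Lc by blast
      have "y \<notin> L" if "x \<in> K t" "y \<in> topspace ?Q" "\<forall>i\<in>F. y i = k x i" for x y
        using that F(3) by (intro F(4)[of "k x" y]) auto
      moreover have "k x i = snd (s u) x i"
        if "u \<in> underS \<tau> t" "i \<in> fst (s u)" "x \<in> topspace Z" for u i x
      proof -
        have "i \<in> J" using that by (auto simp: J_def)
        then show ?thesis using kh h(3) that by simp
      qed
      ultimately have "P s t (F, k)"
        unfolding P_def using F(1,2) k(1,2) h(2) by simp
      then show ?thesis by blast
    qed (simp add: P_def)
  qed
  then obtain s :: "'i \<Rightarrow> 'i set \<times> ('a \<Rightarrow> 'i \<Rightarrow> real)" where s: "\<And>t. P s t (s t)" by blast
  obtain G where G: "continuous_map Z ?Q G" "\<And>x. x \<in> B \<Longrightarrow> G x = g x"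
    "\<And>u i x. u \<in> Field \<tau> \<Longrightarrow> i \<in> fst (s u) \<Longrightarrow> x \<in> topspace Z \<Longrightarrow> G x i = snd (s u) x i"
    using assemble[OF s subset_refl] by blast
  have "G x \<notin> L" if "t \<in> Field \<tau>" "x \<in> K t" for t x
  proof -
    have "G x \<in> topspace ?Q" using G(1) KZ[OF that] by (simp add: continuous_map_into_cube)
    moreover have "\<forall>i\<in>fst (s t). G x i = snd (s t) x i" using G(3) KZ that by blast
    ultimately show ?thesis using s[of t] that by (simp add: P_def)
  qed
  then show ?thesis using G by blast
qed

text \<open>A state consists of a map \<open>k\<close>, a finite set \<open>F\<close> of coordinates and a margin \<open>d\<close>. A
  step moves the coordinates in \<open>F\<close> by at most \<open>d / 2\<close> and at least halves the margin, so that all later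
  steps together move them by at most \<open>d\<close>. The limit therefore still satisfies each certificate
  recorded on the way. Adding the coordinate \<open>c n\<close> at step \<open>n\<close> makes every coordinate converge.\<close>

lemma push_off_countable:
  fixes \<tau> :: "'i rel"
  assumes \<tau>: "Cinfinite \<tau>" and cnt: "countable (Field \<tau>)" and L: "Z_tau_set \<tau> (Tychonov_cube \<tau>) L"
    and Z: "compact_space Z" "Hausdorff_space Z" and B: "closedin Z B"
    and K: "\<And>t. t \<in> Field \<tau> \<Longrightarrow> closedin Z (K t)"
    and g: "continuous_map Z (Tychonov_cube \<tau>) g"
    and gKB: "\<And>t x. t \<in> Field \<tau> \<Longrightarrow> x \<in> K t \<inter> B \<Longrightarrow> g x \<notin> L"
  shows "\<exists>G. continuous_map Z (Tychonov_cube \<tau>) G \<and> (\<forall>x\<in>B. G x = g x) \<and> (\<forall>t\<in>Field \<tau>. \<forall>x\<in>K t. G x \<notin> L)"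
proof -
  let ?Q = "Tychonov_cube \<tau>"
  have Lc: "closedin ?Q L" using L by (simp add: Z_tau_set_def)
  have BZ: "B \<subseteq> topspace Z" using B closedin_subset by blast
  have KZ: "\<And>t x. t \<in> Field \<tau> \<Longrightarrow> x \<in> K t \<Longrightarrow> x \<in> topspace Z" using K closedin_subset by blast
  have "Field \<tau> \<noteq> {}" using \<tau> by (auto simp: cinfinite_def)
  then have "range (from_nat_into (Field \<tau>)) = Field \<tau>" using cnt by (rule range_from_nat_into)
  then obtain c :: "nat \<Rightarrow> 'i" where c: "range c = Field \<tau>" ..
  have cF: "c n \<in> Field \<tau>" for n using c by (metis rangeI)
  define P where "P = (\<lambda>(n::nat) (k, F, d). continuous_map Z ?Q k \<and> (\<forall>x\<in>B. k x = g x) \<and>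
      finite F \<and> F \<subseteq> Field \<tau> \<and> d > (0::real))"
  define R where "R = (\<lambda>n (k, F, d) (k', F', d'). F \<subseteq> F' \<and> c n \<in> F' \<and> d' \<le> d / 2 \<and>
      (\<forall>i\<in>F. \<forall>x\<in>topspace Z. \<bar>k' x i - k x i\<bar> \<le> d / 2) \<and>
      (\<forall>x\<in>K (c n). \<forall>y\<in>topspace ?Q. (\<forall>i\<in>F'. \<bar>y i - k' x i\<bar> \<le> d') \<longrightarrow> y \<notin> L))"
  have "\<exists>f. \<forall>n. P n (f n) \<and> R n (f n) (f (Suc n))"
  proof (rule dependent_nat_choice)
    show "\<exists>p. P 0 p" using g by (intro exI[of _ "(g, {}, 1)"]) (simp add: P_def)
    fix p n assume "P n p"
    moreover obtain k F d where p: "p = (k, F, d)" by (cases p) auto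
    ultimately have k: "continuous_map Z ?Q k" "\<And>x. x \<in> B \<Longrightarrow> k x = g x"
      and F: "finite F" "F \<subseteq> Field \<tau>" and d: "d > 0" by (auto simp: P_def)
    have T: "F \<times> {d / 2} \<subseteq> Field \<tau> \<times> {0<..}" using F d by auto
    have Tc: "|F \<times> {d / 2}| <o \<tau>"
      using \<tau> F(1) by (intro Cfinite_ordLess_Cinfinite) (simp_all add: cfinite_def Field_card_of card_of_card_order_on)
    have kKB: "\<And>x. x \<in> K (c n) \<inter> B \<Longrightarrow> k x \<notin> L" using gKB[OF cF] k(2) by auto
    obtain k' where k': "continuous_map Z ?Q k'" "\<And>x. x \<in> B \<Longrightarrow> k' x = k x"
      "\<And>x. x \<in> K (c n) \<Longrightarrow> k' x \<notin> L"
      "\<And>i e x. (i, e) \<in> F \<times> {d / 2} \<Longrightarrow> x \<in> topspace Z \<Longrightarrow> \<bar>k' x i - k x i\<bar> < e"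
      using push_off_one_compactum[OF \<tau> L Z B K[OF cF] k(1) kKB T Tc] by blast
    have "compactin ?Q (k' ` K (c n))"
      using closedin_compact_space[OF Z(1) K[OF cF]] k'(1) by (rule image_compactin)
    moreover have "k' ` K (c n) \<inter> L = {}" using k'(3) by auto
    ultimately obtain H e where H: "finite H" "H \<subseteq> Field \<tau>" "e > 0"
      "\<And>x y. y \<in> k' ` K (c n) \<Longrightarrow> x \<in> topspace ?Q \<Longrightarrow> (\<And>i. i \<in> H \<Longrightarrow> \<bar>x i - y i\<bar> < e) \<Longrightarrow> x \<notin> L"
      using compact_closed_robustly_disjoint[of \<tau> "k' ` K (c n)" L] Lc by blast
    define d' where "d' = min (d / 2) (e / 2)"
    have d': "d' > 0" "d' \<le> d / 2" "d' < e" using d H(3) by (auto simp: d'_def)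
    define F' where "F' = insert (c n) (F \<union> H)"
    have rob: "y \<notin> L" if "x \<in> K (c n)" "y \<in> topspace ?Q" "\<forall>i\<in>F'. \<bar>y i - k' x i\<bar> \<le> d'" for x y
      using that d'(3) by (intro H(4)[of "k' x" y]) (auto simp: F'_def dest!: bspec)
    have "P (Suc n) (k', F', d')"
      using k'(1,2) k(2) F H(1,2) cF d'(1) by (simp add: P_def F'_def)
    moreover have "R n p (k', F', d')"
      unfolding R_def p prod.case
    proof (intro conjI ballI impI)
      show "\<bar>k' x i - k x i\<bar> \<le> d / 2" if "i \<in> F" "x \<in> topspace Z" for i x
        using k'(4)[of i "d / 2" x] that by simp
    qed (use d'(2) rob in \<open>auto simp: F'_def\<close>)
    ultimately show "\<exists>p'. P (Suc n) p' \<and> R n p p'" by blast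
  qed
  then obtain f where f: "\<And>n. P n (f n)" "\<And>n. R n (f n) (f (Suc n))" by blast
  define k where "k n = fst (f n)" for n
  define F where "F n = fst (snd (f n))" for n
  define d where "d n = snd (snd (f n))" for n
  have k: "continuous_map Z ?Q (k n)" "\<And>x. x \<in> B \<Longrightarrow> k n x = g x" and d0: "d n > 0" for n
    using f(1)[of n] by (auto simp: P_def k_def d_def split: prod.splits)
  have FS: "F n \<subseteq> F (Suc n)" "c n \<in> F (Suc n)" and dS: "d (Suc n) \<le> d n / 2"
    and kS: "\<And>i x. i \<in> F n \<Longrightarrow> x \<in> topspace Z \<Longrightarrow> \<bar>k (Suc n) x i - k n x i\<bar> \<le> d n / 2"
    and rob: "\<And>x y. x \<in> K (c n) \<Longrightarrow> y \<in> topspace ?Q \<Longrightarrow> \<forall>i\<in>F (Suc n). \<bar>y i - k (Suc n) x i\<bar> \<le> d (Suc n) \<Longrightarrow> y \<notin> L" for n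
    using f(2)[of n] by (auto simp: R_def k_def d_def F_def split: prod.splits)
  have Fm: "F n \<subseteq> F m" if "n \<le> m" for n m
    using FS(1) that by (rule lift_Suc_mono_le)
  \<comment> \<open>The summand \<open>d m\<close> on the left, which the next step may still use up, is what makes the induction
    on \<open>m\<close> work.\<close>
  have est: "\<bar>k m x i - k n x i\<bar> + d m \<le> d n" if "n \<le> m" "i \<in> F n" "x \<in> topspace Z" for n m i x
    using that(1)
  proof (induction rule: dec_induct)
    case (step m)
    have "i \<in> F m" using Fm step(1) that(2) by blast
    then show ?case using kS[of i m x] that(3) step.IH dS[of m] by linarith
  qed simp
  have dlim: "d \<longlonglongrightarrow> 0"
  proof (rule real_tendsto_sandwich[of "\<lambda>n. 0" _ _ "\<lambda>n. d 0 * (1/2) ^ n"])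
    have "d n \<le> d 0 * (1/2) ^ n" for n
    proof (induction n)
      case (Suc n)
      then show ?case using dS[of n] by simp
    qed simp
    then show "\<forall>\<^sub>F n in sequentially. d n \<le> d 0 * (1 / 2) ^ n" by simp
    have "(\<lambda>n. d 0 * (1/2) ^ n) \<longlonglongrightarrow> d 0 * 0"
      by (intro tendsto_mult tendsto_const LIMSEQ_power_zero) simp
    then show "(\<lambda>n. d 0 * (1/2) ^ n) \<longlonglongrightarrow> 0" by simp
    show "\<forall>\<^sub>F n in sequentially. 0 \<le> d n" using d0 by (simp add: less_imp_le)
  qed simp
  define G where "G = (\<lambda>x. \<lambda>i\<in>Field \<tau>. lim (\<lambda>n. k n x i))"
  have conv: "(\<lambda>n. k n x i) \<longlonglongrightarrow> G x i" if i: "i \<in> Field \<tau>" and x: "x \<in> topspace Z" for x i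
  proof -
    obtain j where j: "i \<in> F j" using i c FS(2) by (metis rangeE)
    have "Cauchy (\<lambda>n. k n x i)"
    proof (rule metric_CauchyI)
      fix e :: real assume "e > 0"
      then obtain N where N: "d N < e / 2" "j \<le> N"
        using order_tendstoD(2)[OF dlim, of "e / 2"] by (auto simp: eventually_sequentially) (metis le_add1 le_add2)
      have "i \<in> F N" using Fm N(2) j by blast
      then have "\<bar>k m x i - k N x i\<bar> < e / 2" if "m \<ge> N" for m
        using est[OF that _ x, of i] N(1) d0[of m] by linarith
      then have "\<bar>k m x i - k n x i\<bar> < e" if "m \<ge> N" "n \<ge> N" for m n
        using that by (smt (verit) field_sum_of_halves)
      then show "\<exists>M. \<forall>m\<ge>M. \<forall>n\<ge>M. dist (k m x i) (k n x i) < e" by (auto simp: dist_real_def)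
    qed
    then have "convergent (\<lambda>n. k n x i)" by (simp add: Cauchy_convergent_iff)
    then show ?thesis using i by (simp add: G_def convergent_LIMSEQ_iff)
  qed
  have Gest: "\<bar>G x i - k n x i\<bar> \<le> d n" if "i \<in> F n" "i \<in> Field \<tau>" "x \<in> topspace Z" for n i x
  proof (rule LIMSEQ_le_const2)
    show "(\<lambda>m. \<bar>k m x i - k n x i\<bar>) \<longlonglongrightarrow> \<bar>G x i - k n x i\<bar>"
      by (intro tendsto_intros conv that)
    show "\<exists>N. \<forall>m\<ge>N. \<bar>k m x i - k n x i\<bar> \<le> d n"
      using est[OF _ that(1,3)] d0 by (intro exI[of _ n]) (smt (verit))
  qed
  have kQ: "\<And>n x. x \<in> topspace Z \<Longrightarrow> k n x \<in> topspace ?Q" using k(1) by (simp add: continuous_map_into_cube)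
  have GQ: "G x \<in> topspace ?Q" if x: "x \<in> topspace Z" for x
  proof -
    have "0 \<le> G x i" "G x i \<le> 1" if i: "i \<in> Field \<tau>" for i
    proof -
      have "\<And>n. 0 \<le> k n x i" "\<And>n. k n x i \<le> 1" using kQ[OF x] i by (auto simp: in_Tychonov_cube)
      then show "0 \<le> G x i" "G x i \<le> 1"
        using LIMSEQ_le_const[OF conv[OF i x]] LIMSEQ_le_const2[OF conv[OF i x]] by blast+
    qed
    then show ?thesis by (simp add: in_Tychonov_cube G_def)
  qed
  have "continuous_map Z ?Q G"
    unfolding continuous_map_into_cube
  proof (intro conjI ballI)
    show "\<And>x. x \<in> topspace Z \<Longrightarrow> G x \<in> topspace ?Q" by (rule GQ)
    fix i assume i: "i \<in> Field \<tau>"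
    obtain j where j: "i \<in> F j" using i c FS(2) by (metis rangeE)
    have "continuous_map Z Met_TC.mtopology (\<lambda>x. G x i)"
    proof (rule Met_TC.continuous_map_uniform_limit[where F = sequentially and f = "\<lambda>n x. k n x i"])
      show "\<forall>\<^sub>F n in sequentially. continuous_map Z Met_TC.mtopology (\<lambda>x. k n x i)"
        using k(1) i by (simp add: continuous_map_into_cube)
      show "\<forall>\<^sub>F n in sequentially. \<forall>x\<in>topspace Z. G x i \<in> UNIV \<and> dist (k n x i) (G x i) < e" if "e > 0" for e
        using order_tendstoD(2)[OF dlim that] eventually_ge_at_top[of j]
      proof eventually_elim
        case (elim n)
        then show ?case using Gest[of i n] Fm[of j n] j i
          by (auto simp: dist_real_def abs_minus_commute intro: le_less_trans)
      qed
    qed simp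
    then show "continuous_map Z euclideanreal (\<lambda>x. G x i)" by simp
  qed
  moreover have "G x = g x" if "x \<in> B" for x
  proof -
    have "G x i = g x i" if "i \<in> Field \<tau>" for i
      using \<open>x \<in> B\<close> that by (simp add: G_def k(2))
    moreover have "g x \<in> extensional (Field \<tau>)"
      using g that BZ by (auto simp: continuous_map_into_cube in_Tychonov_cube)
    ultimately show ?thesis by (auto simp: G_def extensional_def fun_eq_iff)
  qed
  moreover have "G x \<notin> L" if t: "t \<in> Field \<tau>" and x: "x \<in> K t" for t x
  proof -
    obtain n where n: "t = c n" using c t by auto
    have "F m \<subseteq> Field \<tau>" for m using f(1)[of m] by (auto simp: P_def F_def split: prod.splits)
    then show ?thesis using rob[of x n "G x"] x n GQ Gest KZ[OF t x] by blast
  qed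
  ultimately show ?thesis by blast
qed

text \<open>Besides closedness of \<open>L\<close>, the two implications use only this of the \<open>Z\<^sub>\<tau>\<close>-condition.\<close>

lemma push_off_compacta:
  fixes \<tau> :: "'i rel"
  assumes \<tau>: "Cinfinite \<tau>" and L: "Z_tau_set \<tau> (Tychonov_cube \<tau>) L"
    and Z: "compact_space Z" "Hausdorff_space Z" and B: "closedin Z B"
    and \<K>: "|\<K>| \<le>o \<tau>" "\<And>C. C \<in> \<K> \<Longrightarrow> closedin Z C"
    and g: "continuous_map Z (Tychonov_cube \<tau>) g"
    and gKB: "\<And>x. x \<in> \<Union>\<K> \<inter> B \<Longrightarrow> g x \<notin> L"
  obtains G where "continuous_map Z (Tychonov_cube \<tau>) G" "\<And>x. x \<in> B \<Longrightarrow> G x = g x"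
    "\<And>x. x \<in> \<Union>\<K> \<Longrightarrow> G x \<notin> L"
proof (cases "\<K> = {}")
  case True
  then show thesis using g that[of g] by simp
next
  case False
  have "\<tau> =o |Field \<tau>|" using \<tau> by (simp add: card_of_Field_ordIso ordIso_symmetric)
  with \<K>(1) have "|\<K>| \<le>o |Field \<tau>|" by (rule ordLeq_ordIso_trans)
  then obtain K where K: "K ` Field \<tau> = \<K>" unfolding card_of_ordLeq2[OF False, symmetric] by blast
  have "closedin Z (K t)" if "t \<in> Field \<tau>" for t using K \<K>(2) that by blast
  moreover have "g x \<notin> L" if "t \<in> Field \<tau>" "x \<in> K t \<inter> B" for t x using K gKB that by blast
  ultimately have "\<exists>G. continuous_map Z (Tychonov_cube \<tau>) G \<and> (\<forall>x\<in>B. G x = g x) \<and> (\<forall>t\<in>Field \<tau>. \<forall>x\<in>K t. G x \<notin> L)"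
    using push_off_countable[OF \<tau> _ L Z B _ g, of K] push_off_uncountable[OF \<tau> _ L Z B _ g, of K] by blast
  then show thesis using K that by blast
qed

section \<open>Extending maps to the Stone-Cech compactification\<close>

lemma continuous_map_paste_closed:
  assumes S: "closedin Z S" and T: "closedin Z T"
    and f: "continuous_map (subtopology Z S) Y f" and g: "continuous_map (subtopology Z T) Y g"
    and eq: "\<And>x. x \<in> S \<inter> T \<Longrightarrow> f x = g x"
  shows "continuous_map (subtopology Z (S \<union> T)) Y (\<lambda>x. if x \<in> S then f x else g x)"
proof -
  have SZ: "S \<subseteq> topspace Z" and TZ: "T \<subseteq> topspace Z" using S T closedin_subset by blast+
  show ?thesis
    unfolding continuous_map_closedin
  proof (intro conjI allI impI ballI)
    show "(\<lambda>x. if x \<in> S then f x else g x) \<in> topspace (subtopology Z (S \<union> T)) \<rightarrow> topspace Y"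
      using f g SZ TZ by (auto simp: continuous_map_def Pi_iff)
    fix C assume C: "closedin Y C"
    have "closedin Z {x \<in> S. f x \<in> C}"
      using closedin_continuous_map_preimage[OF f C] S SZ
      by (auto simp: Int_absorb1 intro: closedin_trans_full)
    moreover have "closedin Z {x \<in> T. g x \<in> C}"
      using closedin_continuous_map_preimage[OF g C] T TZ
      by (auto simp: Int_absorb1 intro: closedin_trans_full)
    ultimately have "closedin Z ({x \<in> S. f x \<in> C} \<union> {x \<in> T. g x \<in> C})" by (rule closedin_Un)
    moreover have "{x \<in> topspace (subtopology Z (S \<union> T)). (if x \<in> S then f x else g x) \<in> C} =
        {x \<in> S. f x \<in> C} \<union> {x \<in> T. g x \<in> C}"
      using eq SZ TZ by auto
    ultimately show "closedin (subtopology Z (S \<union> T))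
        {x \<in> topspace (subtopology Z (S \<union> T)). (if x \<in> S then f x else g x) \<in> C}"
      using closedin_closed_subtopology[OF closedin_Un[OF S T]] by auto
  qed
qed

lemma embedding_imp_continuous_map: "embedding_map X Z e \<Longrightarrow> continuous_map X Z e"
  unfolding embedding_map_def
  by (intro continuous_map_into_fulltopology[OF homeomorphic_imp_continuous_map])

lemma openin_beta_emb_image:
  assumes "Tychonov_space X" "locally_compact_space X"
  shows "openin (beta X) (beta_emb X ` topspace X)"
proof (rule dense_locally_compact_openin_Hausdorff_space)
  have emb: "embedding_map X (beta X) (beta_emb X)" using assms(1) by (rule embedding_map_beta_emb)
  show "Hausdorff_space (beta X)" by (rule Hausdorff_space_beta)
  show "beta_emb X ` topspace X \<subseteq> topspace (beta X)"
    using emb embedding_imp_continuous_map continuous_map_image_subset_topspace by blast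
  show "beta X closure_of (beta_emb X ` topspace X) = topspace (beta X)" by (rule dense_beta_emb)
  show "locally_compact_space (subtopology (beta X) (beta_emb X ` topspace X))"
    using homeomorphic_locally_compact_space[OF embedding_map_imp_homeomorphic_space[OF emb]] assms(2) by simp
qed

lemma Tychonov_space_beta: "Tychonov_space (beta X)"
  unfolding Tychonov_space_def
  by (simp add: compact_space_beta Hausdorff_space_beta compact_Hausdorff_or_regular_imp_normal_space
      normal_imp_completely_regular_space)

lemma beta_extension_cube:
  assumes f: "continuous_map X (Tychonov_cube \<tau>) f"
  obtains g where "continuous_map (beta X) (Tychonov_cube \<tau>) g"
    "\<And>x. x \<in> topspace X \<Longrightarrow> g (beta_emb X x) = f x"
proof -
  have "\<exists>g. continuous_map (beta X) (top_of_set {0..1}) g \<and> (\<forall>x\<in>topspace X. g (beta_emb X x) = f x i)"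
    if "i \<in> Field \<tau>" for i
    using f that by (intro beta_extension) (simp add: Tychonov_cube_def continuous_map_componentwise)
  then obtain G where G: "\<And>i. i \<in> Field \<tau> \<Longrightarrow> continuous_map (beta X) (top_of_set {0..1}) (G i)"
    "\<And>i x. i \<in> Field \<tau> \<Longrightarrow> x \<in> topspace X \<Longrightarrow> G i (beta_emb X x) = f x i"
    by metis
  show thesis
  proof (rule that)
    show "continuous_map (beta X) (Tychonov_cube \<tau>) (\<lambda>z. \<lambda>i\<in>Field \<tau>. G i z)"
      unfolding Tychonov_cube_def continuous_map_componentwise using G(1) by (auto cong: restrict_cong)
    show "(\<lambda>i\<in>Field \<tau>. G i (beta_emb X x)) = f x" if "x \<in> topspace X" for x
    proof -
      have "f x \<in> extensional (Field \<tau>)"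
        using f that by (auto simp: continuous_map_into_cube in_Tychonov_cube)
      then show ?thesis using G(2) that by (auto simp: extensional_def fun_eq_iff)
    qed
  qed
qed

text \<open>An extension provided by \<open>C\<^sup>*\<close>-embeddedness is bounded but may leave the unit interval;
  truncating it does not change it on \<open>A\<close>.\<close>

lemma C_star_embedded_cube_extension:
  assumes A: "C_star_embedded X A" and f: "continuous_map (subtopology X A) (Tychonov_cube \<tau>) f"
  obtains g where "continuous_map X (Tychonov_cube \<tau>) g" "\<And>x. x \<in> A \<Longrightarrow> g x = f x"
proof -
  have AX: "A \<subseteq> topspace X" using A by (simp add: C_star_embedded_def)
  have fQ: "f x \<in> topspace (Tychonov_cube \<tau>)" if "x \<in> A" for x
    using f AX that by (auto simp: continuous_map_into_cube)
  have "\<exists>g. continuous_map X euclideanreal g \<and> (\<forall>x\<in>A. g x = f x i)" if i: "i \<in> Field \<tau>" for i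
  proof -
    have "continuous_map (subtopology X A) euclideanreal (\<lambda>x. f x i)"
      using f i by (simp add: continuous_map_into_cube)
    moreover have "bounded ((\<lambda>x. f x i) ` A)"
      by (rule bounded_subset[OF bounded_closed_interval[of 0 1]])
        (use fQ i in \<open>auto simp: in_Tychonov_cube\<close>)
    ultimately show ?thesis using A unfolding C_star_embedded_def by metis
  qed
  then obtain G where G: "\<And>i. i \<in> Field \<tau> \<Longrightarrow> continuous_map X euclideanreal (G i)"
    "\<And>i x. i \<in> Field \<tau> \<Longrightarrow> x \<in> A \<Longrightarrow> G i x = f x i"
    by metis
  define g where "g = (\<lambda>x. \<lambda>i\<in>Field \<tau>. max 0 (min 1 (G i x)))"
  show thesis
  proof (rule that)
    show "continuous_map X (Tychonov_cube \<tau>) g"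
      unfolding continuous_map_into_cube
    proof (intro conjI ballI)
      fix i assume i: "i \<in> Field \<tau>"
      have "continuous_map X euclideanreal (\<lambda>x. max 0 (min 1 (G i x)))"
        by (intro continuous_intros G(1) i)
      then show "continuous_map X euclideanreal (\<lambda>x. g x i)" using i by (simp add: g_def)
    qed (auto simp: g_def in_Tychonov_cube)
    show "g x = f x" if "x \<in> A" for x
      using fQ[OF that] G(2)[OF _ that] by (auto simp: g_def in_Tychonov_cube extensional_def fun_eq_iff)
  qed
qed

section \<open>Proper maps into the complement and limits in the remainder\<close>

text \<open>If \<open>G\<^sup>-\<^sup>1(L)\<close> is exactly the remainder of \<open>X\<close> in \<open>Z\<close>, then the preimage under \<open>G\<close> of a compactum that
  misses \<open>L\<close> is closed in the compact space \<open>Z\<close> and lies in \<open>X\<close>.\<close>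

lemma compact_proper_map_off_remainder:
  assumes Z: "compact_space Z" and e: "embedding_map X Z e"
    and Q: "Hausdorff_space Q" and G: "continuous_map Z Q G"
    and rem: "\<And>z. z \<in> topspace Z - e ` topspace X \<Longrightarrow> G z \<in> L"
    and off: "\<And>x. x \<in> topspace X \<Longrightarrow> G (e x) \<notin> L"
  shows "compact_proper_map X (subtopology Q (topspace Q - L)) (G \<circ> e)"
  unfolding compact_proper_map_def
proof (intro conjI allI impI)
  have ec: "continuous_map X Z e" using e by (rule embedding_imp_continuous_map)
  then have Ge: "continuous_map X Q (G \<circ> e)" using G by (rule continuous_map_compose)
  then have "(G \<circ> e) ` topspace X \<subseteq> topspace Q" by (rule continuous_map_image_subset_topspace)
  then show "continuous_map X (subtopology Q (topspace Q - L)) (G \<circ> e)"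
    using off Ge by (auto simp: continuous_map_in_subtopology)
  fix C assume "compactin (subtopology Q (topspace Q - L)) C"
  then have C: "compactin Q C" "C \<inter> L = {}" by (auto simp: compactin_subtopology)
  then have "closedin Q C" using Q by (simp add: compactin_imp_closedin)
  then have "compactin Z {z \<in> topspace Z. G z \<in> C}"
    using Z G by (intro closedin_compact_space closedin_continuous_map_preimage)
  moreover have "{z \<in> topspace Z. G z \<in> C} = e ` {x \<in> topspace X. (G \<circ> e) x \<in> C}" (is "_ = e ` ?D")
    using rem C(2) ec by (auto simp: continuous_map_def Pi_iff)
  ultimately have "compactin (subtopology Z (e ` topspace X)) (e ` ?D)"
    by (auto simp: compactin_subtopology)
  moreover have "homeomorphic_map X (subtopology Z (e ` topspace X)) e"
    using e by (simp add: embedding_map_def)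
  ultimately show "compactin X ?D"
    using homeomorphic_map_compactness[of X "subtopology Z (e ` topspace X)" e ?D] by auto
qed

text \<open>If \<open>G z\<close> were outside \<open>L\<close>, it would have a compact neighbourhood \<open>C\<close> in the complement of \<open>L\<close>. Near \<open>z\<close>
  the set \<open>e ` A\<close> would be contained in the image of the compact set \<open>f\<^sup>-\<^sup>1(C)\<close>, which is closed and
  does not contain \<open>z\<close>.\<close>

lemma compact_proper_map_limits:
  assumes Z: "Hausdorff_space Z" and e: "continuous_map X Z e" and A: "A \<subseteq> topspace X"
    and Q: "compact_space Q" "Hausdorff_space Q" and L: "closedin Q L"
    and f: "compact_proper_map (subtopology X A) (subtopology Q (topspace Q - L)) f"
    and G: "continuous_map Z Q G" and Gf: "\<And>x. x \<in> A \<Longrightarrow> G (e x) = f x"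
    and z: "z \<in> Z closure_of (e ` A)" "z \<notin> e ` A"
  shows "G z \<in> L"
proof (rule ccontr)
  assume "G z \<notin> L"
  have zZ: "z \<in> topspace Z" using z(1) closure_of_subset_topspace by fast
  then have "G z \<in> topspace Q - L" using G \<open>G z \<notin> L\<close> by (auto simp: continuous_map_def Pi_iff)
  moreover have "openin Q (topspace Q - L)" using L by (simp add: openin_diff)
  moreover have "regular_space Q"
    using Q compact_Hausdorff_imp_regular_space by blast
  ultimately obtain V C where V: "openin Q V" "closedin Q C" "G z \<in> V" "V \<subseteq> C" "C \<subseteq> topspace Q - L"
    unfolding neighbourhood_base_of_closedin[symmetric] neighbourhood_base_of by meson
  have "compactin (subtopology Q (topspace Q - L)) C"
    using V Q(1) by (simp add: compactin_subtopology closedin_compact_space)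
  then have "compactin (subtopology X A) {x \<in> topspace (subtopology X A). f x \<in> C}"
    using f by (simp add: compact_proper_map_def)
  moreover have "topspace (subtopology X A) = A" using A by auto
  ultimately have "compactin X {x \<in> A. f x \<in> C}" (is "compactin X ?D")
    by (simp add: compactin_subtopology del: topspace_subtopology)
  then have D: "closedin Z (e ` ?D)" using image_compactin[OF _ e] Z by (auto intro: compactin_imp_closedin)
  have "openin Z (({y \<in> topspace Z. G y \<in> V}) - e ` ?D)"
    using openin_continuous_map_preimage[OF G V(1)] D by (rule openin_diff)
  moreover have "z \<in> {y \<in> topspace Z. G y \<in> V} - e ` ?D" using zZ V(3) z(2) by auto
  ultimately obtain y where "y \<in> e ` A" "y \<in> {y \<in> topspace Z. G y \<in> V} - e ` ?D"
    using z(1) unfolding in_closure_of by meson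
  then show False using Gf V(4) by auto
qed

lemma ANR_space_neighbourhood_retraction:
  assumes L: "compactin (Tychonov_cube \<tau>) L"
    and ANR: "ANR_space TYPE('i \<Rightarrow> real) (subtopology (Tychonov_cube (\<tau> :: 'i rel)) L)"
  obtains V r where "openin (Tychonov_cube \<tau>) V" "L \<subseteq> V"
    "continuous_map (subtopology (Tychonov_cube \<tau>) V) (subtopology (Tychonov_cube \<tau>) L) r"
    "\<And>x. x \<in> L \<Longrightarrow> r x = x"
proof -
  let ?Q = "Tychonov_cube \<tau>"
  have tL: "topspace (subtopology ?Q L) = L" using compactin_subset_topspace[OF L] by auto
  have "closedin ?Q L" using L Hausdorff_space_cube by (rule compactin_imp_closedin[rotated])
  moreover have "embedding_map (subtopology ?Q L) ?Q id"
    by (simp add: embedding_map_def tL del: topspace_subtopology)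
  ultimately have "Tychonov_space ?Q \<and> embedding_map (subtopology ?Q L) ?Q id \<and> closedin ?Q (id ` L)"
    by (simp add: Tychonov_space_cube)
  then have "\<exists>V. openin ?Q V \<and> id ` L \<subseteq> V \<and> (id ` L) retract_of_space (subtopology ?Q V)"
    using ANR unfolding ANR_space_def tL by blast
  then obtain V where V: "openin ?Q V" "L \<subseteq> V" "L retract_of_space (subtopology ?Q V)"
    by auto
  then obtain r where "continuous_map (subtopology ?Q V) (subtopology ?Q L) r" "\<And>x. x \<in> L \<Longrightarrow> r x = x"
    by (auto simp: retract_of_space_def subtopology_subtopology inf.absorb2)
  with V that show thesis by blast
qed

section \<open>The two implications\<close>

text \<open>The inclusion \<open>X \<subseteq> \<beta>X\<close> is the map \<open>\<iota>\<close>; \<open>core\<close> is the copy of \<open>X\<close> in \<open>\<beta>X\<close>, and local compactness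
  says that its complement \<open>rem\<close> is closed.\<close>

locale locally_compact_Tychonov =
  fixes X :: "'a topology"
  assumes Tych: "Tychonov_space X" and lc: "locally_compact_space X"
begin

abbreviation "\<iota> \<equiv> beta_emb X"
abbreviation "core \<equiv> beta_emb X ` topspace X"
abbreviation "rem \<equiv> topspace (beta X) - beta_emb X ` topspace X"

lemma emb: "embedding_map X (beta X) \<iota>" using Tych by (rule embedding_map_beta_emb)

lemma cont: "continuous_map X (beta X) \<iota>" using emb by (rule embedding_imp_continuous_map)

lemma hom: "homeomorphic_map X (subtopology (beta X) core) \<iota>" using emb by (simp add: embedding_map_def)

lemma closedin_rem: "closedin (beta X) rem"
  using openin_beta_emb_image[OF Tych lc] by (simp add: closedin_diff)

lemma closure_in_image: "S \<subseteq> topspace X \<Longrightarrow> core \<inter> (beta X closure_of (\<iota> ` S)) = \<iota> ` (X closure_of S)"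
  using homeomorphic_map_closure_of[OF hom, of S]
  by (simp add: closure_of_subtopology image_mono inf.absorb2)

lemma topspace_remainder: "topspace (beta_remainder X) = rem"
  by (auto simp: beta_remainder_def)

text \<open>The boundary values that properness forces on the closure \<open>A'\<close> of \<open>A\<close> are extended over the whole
  remainder by the absolute extensor property of \<open>L\<close>; only then is \<open>X\<close> pushed off \<open>L\<close>, relative to
  \<open>A'\<close> and the remainder.\<close>

lemma abs_extensor_imp_proper:
  fixes \<tau> :: "'i rel"
  assumes \<tau>: "Cinfinite \<tau>"
    and \<K>: "|\<K>| \<le>o \<tau>" "\<forall>K\<in>\<K>. compactin X K" "\<Union>\<K> = topspace X"
    and L: "Z_tau_set \<tau> (Tychonov_cube \<tau>) L"
    and AE: "abs_extensor (subtopology (Tychonov_cube \<tau>) L) (beta_remainder X)"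
  shows "abs_extensor_proper (subtopology (Tychonov_cube \<tau>) (topspace (Tychonov_cube \<tau>) - L)) X"
  unfolding abs_extensor_proper_def
proof (intro allI impI; elim conjE)
  let ?Q = "Tychonov_cube \<tau>"
  have Lc: "closedin ?Q L" using L by (simp add: Z_tau_set_def)
  fix A f assume A: "closedin X A" "C_star_embedded X A"
    and f: "compact_proper_map (subtopology X A) (subtopology ?Q (topspace ?Q - L)) f"
  have AX: "A \<subseteq> topspace X" using A(1) by (rule closedin_subset)
  have fc: "continuous_map (subtopology X A) ?Q f" and fL: "\<And>x. x \<in> A \<Longrightarrow> f x \<notin> L"
    using f AX by (auto simp: compact_proper_map_def continuous_map_in_subtopology)
  obtain F where F: "continuous_map X ?Q F" "\<And>x. x \<in> A \<Longrightarrow> F x = f x"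
    using C_star_embedded_cube_extension[OF A(2) fc] by blast
  obtain g where g: "continuous_map (beta X) ?Q g" "\<And>x. x \<in> topspace X \<Longrightarrow> g (\<iota> x) = F x"
    using beta_extension_cube[OF F(1)] by blast
  have gf: "g (\<iota> x) = f x" if "x \<in> A" for x using g(2) F(2) AX that by auto
  define A' where "A' = beta X closure_of (\<iota> ` A)"
  have A': "closedin (beta X) A'" by (simp add: A'_def)
  have A'I: "core \<inter> A' = \<iota> ` A"
    using closure_in_image[OF AX] A(1) by (simp add: A'_def closure_of_closedin)
  have gL: "g z \<in> L" if z: "z \<in> A' \<inter> rem" for z
  proof (rule compact_proper_map_limits[OF Hausdorff_space_beta cont AX compact_space_cube
        Hausdorff_space_cube Lc f g(1)])
    show "g (\<iota> x) = f x" if "x \<in> A" for x using that by (rule gf)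
  qed (use z AX in \<open>auto simp: A'_def\<close>)
  have RA: "closedin (beta_remainder X) (A' \<inter> rem)"
    unfolding beta_remainder_def closedin_subtopology using A' by blast
  have "continuous_map (subtopology (beta_remainder X) (A' \<inter> rem)) (subtopology ?Q L) g"
    unfolding beta_remainder_def subtopology_subtopology
    using gL g(1) by (auto simp: continuous_map_in_subtopology continuous_map_from_subtopology)
  then obtain h where h: "continuous_map (beta_remainder X) (subtopology ?Q L) h"
    "\<And>z. z \<in> A' \<inter> rem \<Longrightarrow> h z = g z"
    using AE RA unfolding abs_extensor_def by metis
  define k where "k z = (if z \<in> rem then h z else g z)" for z
  have "continuous_map (subtopology (beta X) (rem \<union> A')) ?Q k"
    unfolding k_def
  proof (rule continuous_map_paste_closed[OF closedin_rem A'])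
    show "continuous_map (subtopology (beta X) rem) ?Q h"
      using h(1) by (simp add: beta_remainder_def continuous_map_in_subtopology)
    show "continuous_map (subtopology (beta X) A') ?Q g"
      using g(1) by (rule continuous_map_from_subtopology)
  qed (use h(2) in auto)
  moreover have B: "closedin (beta X) (rem \<union> A')" using closedin_rem A' by (rule closedin_Un)
  moreover have "compactin (beta X) (rem \<union> A')" using B by (simp add: closedin_compact_space compact_space_beta)
  ultimately obtain G1 where G1: "continuous_map (beta X) ?Q G1" "\<And>z. z \<in> rem \<union> A' \<Longrightarrow> G1 z = k z"
    using cube_extension[OF Tychonov_space_beta] by metis
  have kA: "k (\<iota> x) = f x" if "x \<in> A" for x
    using gf that AX by (auto simp: k_def)
  have bK: "closedin (beta X) C" if "C \<in> (`) \<iota> ` \<K>" for C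
    using that \<K>(2) image_compactin[OF _ cont] Hausdorff_space_beta by (auto intro: compactin_imp_closedin)
  have UK: "\<Union> ((`) \<iota> ` \<K>) = core" using \<K>(3) by auto
  have cK: "|(`) \<iota> ` \<K>| \<le>o \<tau>" using card_of_image \<K>(1) by (rule ordLeq_transitive)
  have off: "G1 z \<notin> L" if "z \<in> \<Union> ((`) \<iota> ` \<K>) \<inter> (rem \<union> A')" for z
  proof -
    have "z \<in> core \<inter> A'" using that unfolding UK by auto
    then obtain x where x: "x \<in> A" "z = \<iota> x" using A'I by auto
    then show ?thesis using G1(2)[of z] kA[OF x(1)] fL[OF x(1)] that by auto
  qed
  obtain G where G: "continuous_map (beta X) ?Q G" "\<And>z. z \<in> rem \<union> A' \<Longrightarrow> G z = G1 z"
    "\<And>z. z \<in> \<Union> ((`) \<iota> ` \<K>) \<Longrightarrow> G z \<notin> L"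
    using push_off_compacta[OF \<tau> L compact_space_beta Hausdorff_space_beta B cK bK G1(1) off] by blast
  have "compact_proper_map X (subtopology ?Q (topspace ?Q - L)) (G \<circ> \<iota>)"
  proof (rule compact_proper_map_off_remainder[OF compact_space_beta emb Hausdorff_space_cube G(1)])
    show "G z \<in> L" if "z \<in> rem" for z
    proof -
      have "h z \<in> L" using h(1) that topspace_remainder
        by (auto simp: continuous_map_in_subtopology Pi_iff)
      then show ?thesis using G(2) G1(2) that by (simp add: k_def)
    qed
    show "G (\<iota> x) \<notin> L" if "x \<in> topspace X" for x using G(3)[unfolded UK] that by auto
  qed
  moreover have "(G \<circ> \<iota>) x = f x" if "x \<in> A" for x
  proof -
    have "\<iota> x \<in> A'" using A'I that by auto
    then show ?thesis using G(2)[of "\<iota> x"] G1(2)[of "\<iota> x"] kA[OF that] by simp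
  qed
  ultimately show "\<exists>g. compact_proper_map X (subtopology ?Q (topspace ?Q - L)) g \<and> (\<forall>x\<in>A. g x = f x)"
    by blast
qed

text \<open>Near \<open>A\<close> the retraction onto \<open>L\<close> extends \<open>f\<close>. That partial extension is converted into a proper map
  on the trace \<open>M\<close> of a closed neighbourhood \<open>S\<close> of \<open>A\<close>, extended over \<open>X\<close> as a proper map, and read off
  on the remainder again.\<close>

lemma proper_imp_abs_extensor:
  fixes \<tau> :: "'i rel"
  assumes \<tau>: "Cinfinite \<tau>"
    and \<K>: "|\<K>| \<le>o \<tau>" "\<forall>K\<in>\<K>. compactin X K" "\<Union>\<K> = topspace X"
    and reg: "\<forall>F. regular_closedin X F \<longrightarrow> C_star_embedded X F"
    and Lk: "compactin (Tychonov_cube \<tau>) L"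
    and ANR: "ANR_space TYPE('i \<Rightarrow> real) (subtopology (Tychonov_cube \<tau>) L)"
    and L: "Z_tau_set \<tau> (Tychonov_cube \<tau>) L"
    and AEp: "abs_extensor_proper (subtopology (Tychonov_cube \<tau>) (topspace (Tychonov_cube \<tau>) - L)) X"
  shows "abs_extensor (subtopology (Tychonov_cube \<tau>) L) (beta_remainder X)"
  unfolding abs_extensor_def
proof (intro allI impI; elim conjE)
  let ?Q = "Tychonov_cube \<tau>"
  have Lc: "closedin ?Q L" using L by (simp add: Z_tau_set_def)
  fix A f assume A: "closedin (beta_remainder X) A"
    and f: "continuous_map (subtopology (beta_remainder X) A) (subtopology ?Q L) f"
  have AR: "A \<subseteq> rem" using closedin_subset[OF A] topspace_remainder by simp
  have Ab: "closedin (beta X) A" using A closedin_rem unfolding beta_remainder_def by (rule closedin_trans_full)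
  have fA: "continuous_map (subtopology (beta X) A) ?Q f" and fL: "\<And>z. z \<in> A \<Longrightarrow> f z \<in> L"
    using f AR by (auto simp: beta_remainder_def subtopology_subtopology Int_absorb1 continuous_map_in_subtopology)
  obtain g where g: "continuous_map (beta X) ?Q g" "\<And>z. z \<in> A \<Longrightarrow> g z = f z"
    using cube_extension[OF Tychonov_space_beta closedin_compact_space[OF compact_space_beta Ab] fA] by blast
  obtain V r where V: "openin ?Q V" "L \<subseteq> V" and r: "continuous_map (subtopology ?Q V) (subtopology ?Q L) r"
    "\<And>y. y \<in> L \<Longrightarrow> r y = y"
    using ANR_space_neighbourhood_retraction[OF Lk ANR] by blast
  have "openin (beta X) {z \<in> topspace (beta X). g z \<in> V}" (is "openin _ ?N")
    using g(1) V(1) by (rule openin_continuous_map_preimage)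
  moreover have "A \<subseteq> ?N" using AR g(2) fL V(2) by auto
  moreover have "normal_space (beta X)"
    using compact_space_beta Hausdorff_space_beta compact_Hausdorff_or_regular_imp_normal_space by blast
  ultimately obtain W where W: "openin (beta X) W" "A \<subseteq> W" "beta X closure_of W \<subseteq> ?N"
    using Ab unfolding normal_space_alt by meson
  define S where "S = beta X closure_of W"
  have S: "closedin (beta X) S" by (simp add: S_def)
  have WS: "W \<subseteq> S" unfolding S_def using W(1) by (intro closure_of_subset openin_subset)
  have SN: "S \<subseteq> topspace (beta X)" "\<And>z. z \<in> S \<Longrightarrow> g z \<in> V" using W(3) by (auto simp: S_def)
  define Z where "Z = subtopology (beta X) S"
  have tZ: "topspace Z = S" using SN by (auto simp: Z_def)
  have Z: "compact_space Z" "Hausdorff_space Z"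
    unfolding Z_def using closedin_compact_space[OF compact_space_beta S]
    by (simp_all add: compact_space_subtopology Hausdorff_space_subtopology Hausdorff_space_beta)
  have clZ: "closedin Z C \<longleftrightarrow> closedin (beta X) C \<and> C \<subseteq> S" for C
    unfolding Z_def using S by (rule closedin_closed_subtopology)
  have "continuous_map Z (subtopology ?Q V) g"
    unfolding Z_def using g(1) SN by (auto simp: continuous_map_in_subtopology continuous_map_from_subtopology)
  then have "continuous_map Z (subtopology ?Q L) (r \<circ> g)" using r(1) by (rule continuous_map_compose)
  then have rg: "continuous_map Z ?Q (r \<circ> g)" and rgL: "\<And>z. z \<in> S \<Longrightarrow> r (g z) \<in> L"
    using tZ by (auto simp: continuous_map_in_subtopology)
  define \<K>' where "\<K>' = (\<lambda>K. \<iota> ` K \<inter> S) ` \<K>"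
  have UK: "\<Union>\<K>' = core \<inter> S" using \<K>(3) by (auto simp: \<K>'_def)
  have cK: "|\<K>'| \<le>o \<tau>" unfolding \<K>'_def using card_of_image \<K>(1) by (rule ordLeq_transitive)
  have kK: "closedin Z C" if C: "C \<in> \<K>'" for C
  proof -
    obtain K where K: "K \<in> \<K>" "C = \<iota> ` K \<inter> S" using C by (auto simp: \<K>'_def)
    have "closedin (beta X) (\<iota> ` K)"
      using image_compactin[OF _ cont] \<K>(2) K(1) Hausdorff_space_beta by (auto intro: compactin_imp_closedin)
    then show ?thesis unfolding clZ K(2) using S by auto
  qed
  have B: "closedin Z (S \<inter> rem)" unfolding clZ using S closedin_rem by auto
  have off: "(r \<circ> g) z \<notin> L" if "z \<in> \<Union>\<K>' \<inter> (S \<inter> rem)" for z using that UK by auto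
  obtain h where h: "continuous_map Z ?Q h" "\<And>z. z \<in> S \<inter> rem \<Longrightarrow> h z = (r \<circ> g) z"
    "\<And>z. z \<in> \<Union>\<K>' \<Longrightarrow> h z \<notin> L"
    using push_off_compacta[OF \<tau> L Z B cK kK rg off] by blast
  define U where "U = {x \<in> topspace X. \<iota> x \<in> W}"
  define M where "M = X closure_of U"
  have U: "openin X U" unfolding U_def using cont W(1) by (rule openin_continuous_map_preimage)
  have Mreg: "regular_closedin X M" unfolding regular_closedin_def M_def using U by blast
  have Mc: "closedin X M" by (simp add: M_def)
  then have MX: "M \<subseteq> topspace X" by (rule closedin_subset)
  have bU: "\<iota> ` U = W \<inter> core" by (auto simp: U_def)
  \<comment> \<open>As \<open>W\<close> is open and the image of \<open>X\<close> is dense, nothing of \<open>S\<close> is lost by restricting \<open>W\<close> to \<open>X\<close>.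
    Hence \<open>M\<close> is the trace of \<open>S\<close> on \<open>X\<close>, and maps on \<open>S\<close> are determined by their values on \<open>M\<close>.\<close>
  have "beta X closure_of (\<iota> ` U) = S"
    using closure_of_openin_Int_closure_of[OF W(1), of core] openin_subset[OF W(1)]
    by (simp add: bU S_def dense_beta_emb Int_absorb2)
  then have SM: "beta X closure_of (\<iota> ` U) = S" and bM: "\<iota> ` M = core \<inter> S"
    using closure_in_image[of U] by (auto simp: U_def M_def)
  have "homeomorphic_map (subtopology X M) (subtopology (subtopology (beta X) core) S) \<iota>"
    using bM SN(1) by (intro homeomorphic_map_subtopologies[OF hom]) (auto simp: Int_absorb1 MX)
  moreover have tM: "topspace (subtopology X M) = M" using MX by auto
  moreover have "subtopology (subtopology (beta X) core) S = subtopology Z (\<iota> ` M)"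
    by (simp add: Z_def subtopology_subtopology bM Int_ac)
  ultimately have embM: "embedding_map (subtopology X M) Z \<iota>"
    unfolding embedding_map_def by (simp del: topspace_subtopology)
  have "compact_proper_map (subtopology X M) (subtopology ?Q (topspace ?Q - L)) (h \<circ> \<iota>)"
  proof (rule compact_proper_map_off_remainder[OF Z(1) embM Hausdorff_space_cube h(1)])
    show "h z \<in> L" if "z \<in> topspace Z - \<iota> ` topspace (subtopology X M)" for z
    proof -
      have "z \<in> S \<inter> rem" using that SN unfolding tM tZ bM by auto
      then show ?thesis using h(2) rgL by simp
    qed
    show "h (\<iota> x) \<notin> L" if "x \<in> topspace (subtopology X M)" for x
    proof -
      have "\<iota> x \<in> core \<inter> S" using imageI[of x M \<iota>] that unfolding tM bM .
      then show ?thesis using h(3) unfolding UK by blast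
    qed
  qed
  moreover have "C_star_embedded X M" using reg Mreg by blast
  ultimately have "\<exists>H. compact_proper_map X (subtopology ?Q (topspace ?Q - L)) H \<and> (\<forall>x\<in>M. H x = (h \<circ> \<iota>) x)"
    using AEp[unfolded abs_extensor_proper_def, rule_format, of M "h \<circ> \<iota>"] Mc by simp
  then obtain H where H: "compact_proper_map X (subtopology ?Q (topspace ?Q - L)) H"
    "\<And>x. x \<in> M \<Longrightarrow> H x = h (\<iota> x)" by auto
  have "continuous_map X ?Q H" using H(1) by (auto simp: compact_proper_map_def continuous_map_in_subtopology)
  then obtain E where E: "continuous_map (beta X) ?Q E" "\<And>x. x \<in> topspace X \<Longrightarrow> E (\<iota> x) = H x"
    using beta_extension_cube by blast
  have "compact_proper_map (subtopology X (topspace X)) (subtopology ?Q (topspace ?Q - L)) H"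
    using H(1) by simp
  note lim = compact_proper_map_limits[OF Hausdorff_space_beta cont subset_refl compact_space_cube
      Hausdorff_space_cube Lc this E(1)]
  have EL: "E z \<in> L" if z: "z \<in> rem" for z
    by (rule lim) (use z E(2) in \<open>auto simp: dense_beta_emb\<close>)
  have Eh: "E z = h z" if z: "z \<in> S" for z
  proof (rule forall_in_closure_of_eq[of z Z "\<iota> ` U" ?Q E h])
    show "continuous_map Z ?Q E" unfolding Z_def using E(1) by (rule continuous_map_from_subtopology)
    have "\<iota> ` U \<subseteq> S" using bU WS by auto
    then show "z \<in> Z closure_of (\<iota> ` U)"
      using z SM by (simp add: Z_def closure_of_subtopology Int_absorb1)
    show "E y = h y" if y: "y \<in> \<iota> ` U" for y
    proof -
      obtain x where x: "x \<in> U" "y = \<iota> x" using y by auto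
      then have "x \<in> M" using closure_of_subset[OF openin_subset[OF U]] by (auto simp: M_def)
      then show ?thesis using x E(2) H(2) MX by auto
    qed
  qed (rule Hausdorff_space_cube h(1))+
  have "continuous_map (beta_remainder X) (subtopology ?Q L) E"
    unfolding beta_remainder_def
    using E(1) EL by (auto simp: continuous_map_in_subtopology continuous_map_from_subtopology)
  moreover have "E z = f z" if z: "z \<in> A" for z
  proof -
    have "z \<in> S \<inter> rem" using z W(2) WS AR by auto
    then show ?thesis using Eh h(2) g(2)[OF z] r(2)[OF fL[OF z]] by simp
  qed
  ultimately show "\<exists>g. continuous_map (beta_remainder X) (subtopology ?Q L) g \<and> (\<forall>x\<in>A. g x = f x)"
    by blast
qed

end

theorem theorem4p1:
  fixes \<tau> :: "'i rel" and X :: "'a topology" and L :: "('i \<Rightarrow> real) set"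
  assumes "Cinfinite \<tau>"
    and "Tychonov_space X" and "locally_compact_space X"
    and "\<exists>\<K>. |\<K>| \<le>o \<tau> \<and> (\<forall>K\<in>\<K>. compactin X K) \<and> \<Union>\<K> = topspace X"
    and "\<forall>F. regular_closedin X F \<longrightarrow> C_star_embedded X F"
    and "compactin (Tychonov_cube \<tau>) L"
    and "ANR_space TYPE('i \<Rightarrow> real) (subtopology (Tychonov_cube \<tau>) L)"
    and "Z_tau_set \<tau> (Tychonov_cube \<tau>) L"
  shows "abs_extensor (subtopology (Tychonov_cube \<tau>) L) (beta_remainder X) \<longleftrightarrow>
         abs_extensor_proper (subtopology (Tychonov_cube \<tau>) (topspace (Tychonov_cube \<tau>) - L)) X"
proof -
  obtain \<K> where \<K>: "|\<K>| \<le>o \<tau>" "\<forall>K\<in>\<K>. compactin X K" "\<Union>\<K> = topspace X"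
    using assms(4) by (elim exE conjE)
  interpret locally_compact_Tychonov X using assms(2,3) by unfold_locales
  show ?thesis
    by (rule iffI[OF abs_extensor_imp_proper[OF assms(1) \<K> assms(8)]
          proper_imp_abs_extensor[OF assms(1) \<K> assms(5-8)]])
qed

end
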